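(* The noncommutative Faà di Bruno bialgebra in two noncommuting variables $\mathcal F^{\langle2\rangle,\mathrm{nc}}$ is isomorphic to the homotopy cardinality of the incidence bialgebra of the simplicial groupoid $\mathcal B\,\mathsf{Ass}_2$ (bar construction relative to $\mathsf M^{\mathrm r}$).
   Context: Monads and operads. $\mathsf{M}^{\mathrm r}$ is the monad on the category of groupoids sending $A$ to $\bigsqcup_{n\ge 1}A^n$ (nonempty tuples, morphisms componentwise), unit $a\mapsto (a)$, multiplication $\mu$ concatenation. An $\mathsf M^{\mathrm r}$-operad $Q$ consists of groupoids $Q_0$ (colours), $Q_1$ (operations), functors $s\colon Q_1\to\mathsf M^{\mathrm r}Q_0$, $t\colon Q_1\to Q_0$, composition $m\colon\mathsf M^{\mathrm r}Q_1\times_{\mathsf M^{\mathrm r}Q_0}Q_1\to Q_1$ (the $Q_1$ factor the root) and units, with the usual laws. $\mathsf{Ass}_2$ is the terminal $\mathsf M^{\mathrm r}$-operad on the discrete colour set $K=\{1,2\}$: $Q_0=K$, $Q_1=\mathsf M^{\mathrm r}K\times K$, $s,t$ projections, composition induced by $\mu$. Bar construction. For an $\mathsf M^{\mathrm r}$-operad $Q$, $Q_n:=\mathsf M^{\mathrm r}Q_{n-1}\times_{\mathsf M^{\mathrm r}Q_0}Q_1$ ($n\ge2$). $\mathcal BQ$ has $n$-simplices $\mathsf M^{\mathrm r}Q_n$; $d_0$ discards the top (leafward) level keeping outputs, $d_n$ discards the root level and flattens via $\mu$, inner faces compose adjacent levels via $m$, degeneracies insert units. Incidence bialgebra. $|G|=\sum_{[x]}1/|\mathrm{Aut}(x)|$.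 For $X=\mathcal BQ$, $\mathbb Q_{\pi_0X_1}$ has basis $\delta_a$; $\Delta(\delta_f)=\sum_{a,b}\frac{|\Phi_{f;a,b}|}{|\mathrm{Aut}(a)||\mathrm{Aut}(b)|}\delta_a\otimes\delta_b$ with $\Phi_{f;a,b}$ the homotopy fibre over $(a,b)$ of $(d_2,d_0)$ restricted to the homotopy fibre of $d_1$ over $f$; $\epsilon(\delta_f)=$ cardinality of the homotopy fibre of $s_0$ over $f$; product by concatenation (unit adjoined). The bialgebra. Let $R$ be a noncommutative unital ring. Power series in noncommuting variables $x,y$ without constant term with coefficients in $R$ are written $F=\sum_\omega f_\omega\,\omega$ ($\omega$ nonempty words in $x,y$); pairs form a monoid under $(G^1,G^2)\circ(F^1,F^2)=(G^1(F^1,F^2),G^2(F^1,F^2))$. $\mathcal F^{\langle2\rangle,\mathrm{nc}}$ is the free associative unital algebra on the maps $a^i_\omega(F^1,F^2)=f^i_\omega$ ($i=1,2$), with comultiplication induced by substitution ($\Delta(a^i_\omega)((F^1,F^2),(G^1,G^2))=a^i_\omega((G^1,G^2)\circ(F^1,F^2))$) and counit $\epsilon(a^i_\omega)=a^i_\omega(x,y)$. *)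

theory Defs
  imports Complex_Main "HOL-Library.Poly_Mapping" "HOL-Library.Product_Plus"
begin

section \<open>Groupoids\<close>

record ('o, 'm) gpd =
  obj :: "'o set"
  mor :: "'m set"
  dom :: "'m \<Rightarrow> 'o"
  cod :: "'m \<Rightarrow> 'o"
  idm :: "'o \<Rightarrow> 'm"
  cmp :: "'m \<Rightarrow> 'm \<Rightarrow> 'm"  \<comment> \<open>\<open>cmp G g f\<close> is ``\<open>g\<close> after \<open>f\<close>''\<close>

definition groupoid :: "('o, 'm) gpd \<Rightarrow> bool" where
  "groupoid G \<longleftrightarrow>
     (\<forall>f\<in>mor G. dom G f \<in> obj G \<and> cod G f \<in> obj G) \<and>
     (\<forall>x\<in>obj G. idm G x \<in> mor G \<and> dom G (idm G x) = x \<and> cod G (idm G x) = x) \<and>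
     (\<forall>f\<in>mor G. \<forall>g\<in>mor G. cod G f = dom G g \<longrightarrow>
        cmp G g f \<in> mor G \<and> dom G (cmp G g f) = dom G f \<and> cod G (cmp G g f) = cod G g) \<and>
     (\<forall>f\<in>mor G. cmp G f (idm G (dom G f)) = f \<and> cmp G (idm G (cod G f)) f = f) \<and>
     (\<forall>f\<in>mor G. \<forall>g\<in>mor G. \<forall>h\<in>mor G. cod G f = dom G g \<and> cod G g = dom G h \<longrightarrow>
        cmp G h (cmp G g f) = cmp G (cmp G h g) f) \<and>
     (\<forall>f\<in>mor G. \<exists>g\<in>mor G. dom G g = cod G f \<and> cod G g = dom G f \<and>
        cmp G g f = idm G (dom G f) \<and> cmp G f g = idm G (cod G f))"

record ('o, 'm, 'p, 'n) fctr =
  on_obj :: "'o \<Rightarrow> 'p"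
  on_mor :: "'m \<Rightarrow> 'n"

definition is_functor :: "('o, 'm) gpd \<Rightarrow> ('p, 'n) gpd \<Rightarrow> ('o, 'm, 'p, 'n) fctr \<Rightarrow> bool" where
  "is_functor A B F \<longleftrightarrow>
     (\<forall>x\<in>obj A. on_obj F x \<in> obj B \<and> on_mor F (idm A x) = idm B (on_obj F x)) \<and>
     (\<forall>f\<in>mor A. on_mor F f \<in> mor B \<and> dom B (on_mor F f) = on_obj F (dom A f) \<and>
        cod B (on_mor F f) = on_obj F (cod A f)) \<and>
     (\<forall>f\<in>mor A. \<forall>g\<in>mor A. cod A f = dom A g \<longrightarrow>
        on_mor F (cmp A g f) = cmp B (on_mor F g) (on_mor F f))"

definition fcomp ::
  "('p, 'n, 'q, 'l) fctr \<Rightarrow> ('o, 'm, 'p, 'n) fctr \<Rightarrow> ('o, 'm, 'q, 'l) fctr" where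
  "fcomp G F = \<lparr>on_obj = on_obj G \<circ> on_obj F, on_mor = on_mor G \<circ> on_mor F\<rparr>"

definition fpair ::
  "('o, 'm, 'p, 'n) fctr \<Rightarrow> ('o, 'm, 'q, 'l) fctr \<Rightarrow> ('o, 'm, 'p \<times> 'q, 'n \<times> 'l) fctr" where
  "fpair F G = \<lparr>on_obj = (\<lambda>x. (on_obj F x, on_obj G x)), on_mor = (\<lambda>f. (on_mor F f, on_mor G f))\<rparr>"

definition discrete :: "'a set \<Rightarrow> ('a, 'a) gpd" where
  "discrete S = \<lparr>obj = S, mor = S, dom = id, cod = id, idm = id, cmp = (\<lambda>g f. f)\<rparr>"

definition prod_gpd :: "('o, 'm) gpd \<Rightarrow> ('p, 'n) gpd \<Rightarrow> ('o \<times> 'p, 'm \<times> 'n) gpd" where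
  "prod_gpd A B = \<lparr>obj = obj A \<times> obj B, mor = mor A \<times> mor B,
     dom = map_prod (dom A) (dom B), cod = map_prod (cod A) (cod B),
     idm = map_prod (idm A) (idm B),
     cmp = (\<lambda>(g, k) (f, h). (cmp A g f, cmp B k h))\<rparr>"

text \<open>The strict fibre product of \<open>F\<close> on \<open>A\<close> and \<open>G\<close> on \<open>B\<close>; their common target does not
  enter the construction.\<close>

definition pullback ::
  "('o, 'm) gpd \<Rightarrow> ('o, 'm, 'q, 'l) fctr \<Rightarrow> ('p, 'n) gpd \<Rightarrow> ('p, 'n, 'q, 'l) fctr
     \<Rightarrow> ('o \<times> 'p, 'm \<times> 'n) gpd" where
  "pullback A F B G = (prod_gpd A B)
     \<lparr>obj := {(x, y). x \<in> obj A \<and> y \<in> obj B \<and> on_obj F x = on_obj G y},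
      mor := {(f, g). f \<in> mor A \<and> g \<in> mor B \<and> on_mor F f = on_mor G g}\<rparr>"

text \<open>Transport of a groupoid along injections \<open>c\<close> (on objects, with left inverse \<open>d\<close>) and
  \<open>c'\<close> (on morphisms, with left inverse \<open>d'\<close>).\<close>

definition relabel ::
  "('o \<Rightarrow> 'p) \<Rightarrow> ('p \<Rightarrow> 'o) \<Rightarrow> ('m \<Rightarrow> 'n) \<Rightarrow> ('n \<Rightarrow> 'm) \<Rightarrow> ('o, 'm) gpd \<Rightarrow> ('p, 'n) gpd" where
  "relabel c d c' d' G = \<lparr>obj = c ` obj G, mor = c' ` mor G,
     dom = (\<lambda>f. c (dom G (d' f))), cod = (\<lambda>f. c (cod G (d' f))),
     idm = (\<lambda>x. c' (idm G (d x))), cmp = (\<lambda>g f. c' (cmp G (d' g) (d' f)))\<rparr>"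

subsection \<open>Isomorphism classes, homotopy cardinality, homotopy fibres\<close>

definition homs :: "('o, 'm) gpd \<Rightarrow> 'o \<Rightarrow> 'o \<Rightarrow> 'm set" where
  "homs G x y = {f \<in> mor G. dom G f = x \<and> cod G f = y}"

definition auts :: "('o, 'm) gpd \<Rightarrow> 'o \<Rightarrow> 'm set" where
  "auts G x = homs G x x"

definition iso_class :: "('o, 'm) gpd \<Rightarrow> 'o \<Rightarrow> 'o set" where
  "iso_class G x = {y \<in> obj G. homs G x y \<noteq> {}}"

definition pi0 :: "('o, 'm) gpd \<Rightarrow> 'o set set" where
  "pi0 G = iso_class G ` obj G"

definition rep :: "'o set \<Rightarrow> 'o" where
  "rep c = (SOME x. x \<in> c)"

text \<open>Meaningful for groupoids with finitely many isomorphism classes.\<close>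

definition gcard :: "('o, 'm) gpd \<Rightarrow> rat" where
  "gcard G = (\<Sum>c\<in>pi0 G. 1 / of_nat (card (auts G (rep c))))"

definition hfib ::
  "('o, 'm) gpd \<Rightarrow> ('p, 'n) gpd \<Rightarrow> ('o, 'm, 'p, 'n) fctr \<Rightarrow> 'p
     \<Rightarrow> ('o \<times> 'n, ('o \<times> 'n) \<times> 'm \<times> ('o \<times> 'n)) gpd" where
  "hfib A B F b =
     (let ob = {(x, p). x \<in> obj A \<and> p \<in> homs B (on_obj F x) b} in
      \<lparr>obj = ob,
       mor = {((x, p), f, (y, q)) | x p f y q. (x, p) \<in> ob \<and> (y, q) \<in> ob \<and>
                f \<in> homs A x y \<and> cmp B q (on_mor F f) = p},
       dom = fst,
       cod = snd \<circ> snd,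
       idm = (\<lambda>(x, p). ((x, p), idm A x, (x, p))),
       cmp = (\<lambda>(_, g, z) (x, f, _). (x, cmp A g f, z))\<rparr>)"

definition hfib_incl :: "('o \<times> 'n, ('o \<times> 'n) \<times> 'm \<times> ('o \<times> 'n), 'o, 'm) fctr" where
  "hfib_incl = \<lparr>on_obj = fst, on_mor = fst \<circ> snd\<rparr>"

section \<open>The monad \<open>M\<^sup>r\<close> and its operads\<close>

definition Mr :: "('o, 'm) gpd \<Rightarrow> ('o list, 'm list) gpd" where
  "Mr G = \<lparr>obj = {xs. xs \<noteq> [] \<and> set xs \<subseteq> obj G}, mor = {fs. fs \<noteq> [] \<and> set fs \<subseteq> mor G},
     dom = map (dom G), cod = map (cod G), idm = map (idm G), cmp = map2 (cmp G)\<rparr>"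

definition Mr_map :: "('o, 'm, 'p, 'n) fctr \<Rightarrow> ('o list, 'm list, 'p list, 'n list) fctr" where
  "Mr_map F = \<lparr>on_obj = map (on_obj F), on_mor = map (on_mor F)\<rparr>"

definition Mr_mult :: "('o list list, 'm list list, 'o list, 'm list) fctr" where
  "Mr_mult = \<lparr>on_obj = concat, on_mor = concat\<rparr>"

record ('c, 'd, 'q, 'p) operad =
  colours :: "('c, 'd) gpd"
  ops :: "('q, 'p) gpd"
  src :: "('q, 'p, 'c list, 'd list) fctr"
  tgt :: "('q, 'p, 'c, 'd) fctr"
  ocomp :: "('q list \<times> 'q, 'p list \<times> 'p, 'q, 'p) fctr"
  ounit :: "('c, 'd, 'q, 'p) fctr"

text \<open>The operad laws, for underlying sets \<open>C\<close> of colours and \<open>Q\<close> of operations.\<close>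

definition operad_laws ::
  "'c set \<Rightarrow> 'q set \<Rightarrow> ('q \<Rightarrow> 'c list) \<Rightarrow> ('q \<Rightarrow> 'c) \<Rightarrow> ('q list \<times> 'q \<Rightarrow> 'q) \<Rightarrow> ('c \<Rightarrow> 'q) \<Rightarrow> bool" where
  "operad_laws C Q s t m u \<longleftrightarrow>
     (\<forall>c\<in>C. s (u c) = [c] \<and> t (u c) = c) \<and>
     (\<forall>q\<in>Q. m ([q], u (t q)) = q \<and> m (map u (s q), q) = q) \<and>
     (\<forall>q\<in>Q. \<forall>qs\<in>lists Q. map t qs = s q \<longrightarrow>
        t (m (qs, q)) = t q \<and> s (m (qs, q)) = concat (map s qs) \<and>
        (\<forall>rss\<in>lists (lists Q). map (map t) rss = map s qs \<longrightarrow>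
           m (concat rss, m (qs, q)) = m (map m (zip rss qs), q)))"

definition Mr_operad :: "('c, 'd, 'q, 'p) operad \<Rightarrow> bool" where
  "Mr_operad Q \<longleftrightarrow>
     groupoid (colours Q) \<and> groupoid (ops Q) \<and>
     is_functor (ops Q) (Mr (colours Q)) (src Q) \<and>
     is_functor (ops Q) (colours Q) (tgt Q) \<and>
     is_functor (pullback (Mr (ops Q)) (Mr_map (tgt Q)) (ops Q) (src Q)) (ops Q) (ocomp Q) \<and>
     is_functor (colours Q) (ops Q) (ounit Q) \<and>
     operad_laws (obj (colours Q)) (obj (ops Q))
       (on_obj (src Q)) (on_obj (tgt Q)) (on_obj (ocomp Q)) (on_obj (ounit Q)) \<and>
     operad_laws (mor (colours Q)) (mor (ops Q))
       (on_mor (src Q)) (on_mor (tgt Q)) (on_mor (ocomp Q)) (on_mor (ounit Q))"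

text \<open>The terminal operad on a discrete set \<open>K\<close> of colours. The unit of a colour is forced by
  terminality.\<close>

definition Ass :: "'k set \<Rightarrow> ('k, 'k, 'k list \<times> 'k, 'k list \<times> 'k) operad" where
  "Ass K = \<lparr>colours = discrete K,
     ops = prod_gpd (Mr (discrete K)) (discrete K),
     src = \<lparr>on_obj = fst, on_mor = fst\<rparr>,
     tgt = \<lparr>on_obj = snd, on_mor = snd\<rparr>,
     ocomp = \<lparr>on_obj = (\<lambda>(qs, q). (concat (map fst qs), snd q)),
              on_mor = (\<lambda>(qs, q). (concat (map fst qs), snd q))\<rparr>,
     ounit = \<lparr>on_obj = (\<lambda>c. ([c], c)), on_mor = (\<lambda>c. ([c], c))\<rparr>\<rparr>"

text \<open>The two-element set \<open>{1, 2}\<close>. It serves as the set of colours, as the index set of pairs of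
  power series, and as the set of variables, with \<open>I1\<close> standing for \<open>x\<close> and \<open>I2\<close> for \<open>y\<close>.\<close>

datatype two = I1 | I2

definition Ass2 :: "(two, two, two list \<times> two, two list \<times> two) operad" where
  "Ass2 = Ass UNIV"

lemma Mr_operad_Ass2: "Mr_operad Ass2"
proof -
  have map2_id: "length xs = length ys \<Longrightarrow> map2 (\<lambda>a b. b) xs ys = ys" for xs ys :: "'z list"
    by (induction xs ys rule: list_induct2) auto
  have map2_fst: "map (fst \<circ> (\<lambda>((g, k), f, y). (map2 (\<lambda>x y. y) g f, y))) (zip xs xs) = map fst xs"
    for xs :: "(two list \<times> two) list"
    by (induction xs) (auto simp: map2_id)
  have ne: "\<exists>q\<in>set qs. fst q \<noteq> []"
    if "qs \<noteq> []" "set qs \<subseteq> {xs. xs \<noteq> []} \<times> UNIV" for qs :: "(two list \<times> two) list"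
    using that by (cases qs) auto
  have disc: "groupoid (discrete UNIV :: (two, two) gpd)"
    by (auto simp: groupoid_def discrete_def)
  have ops: "groupoid (prod_gpd (Mr (discrete UNIV)) (discrete UNIV) :: (two list \<times> two, two list \<times> two) gpd)"
    by (auto simp: groupoid_def discrete_def prod_gpd_def Mr_def map2_id)
  have laws: "operad_laws UNIV ({xs :: two list. xs \<noteq> []} \<times> UNIV) fst snd
      (\<lambda>(qs, q). (concat (map fst qs), snd q)) (\<lambda>c. ([c], c))"
  proof -
    have c1: "concat (map (\<lambda>c. [c]) xs) = xs" for xs :: "two list" by (induction xs) auto
    have c2: "concat (map fst (concat rss)) = concat (map fst (map (\<lambda>(qs, q). (concat (map fst qs), snd q)) (zip rss qs)))"
      if "length rss = length qs" for rss :: "(two list \<times> two) list list" and qs :: "(two list \<times> two) list"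
      using that by (induction rss qs rule: list_induct2) auto
    show ?thesis
      using c1 c2 by (auto simp: operad_laws_def comp_def dest: map_eq_imp_length_eq)
  qed
  show ?thesis
    apply (simp add: Mr_operad_def disc ops Ass2_def Ass_def)
    apply (intro conjI)
    subgoal by (auto simp: is_functor_def discrete_def prod_gpd_def Mr_def)
    subgoal by (auto simp: is_functor_def discrete_def prod_gpd_def Mr_def)
    subgoal by (auto simp: is_functor_def discrete_def prod_gpd_def Mr_def pullback_def Mr_map_def map2_id map2_fst ne prod.map_id0)
    subgoal by (auto simp: is_functor_def discrete_def prod_gpd_def Mr_def)
    subgoal using laws by (simp add: discrete_def prod_gpd_def Mr_def Mr_mult_def)
    subgoal using laws by (simp add: discrete_def prod_gpd_def Mr_def Mr_mult_def)
    done
qed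
section \<open>The bar construction\<close>

text \<open>Level trees, a common type for the objects (and likewise the morphisms) of all the groupoids
  \<open>Q\<^sub>n\<close>: \<open>Q\<^sub>0\<close> and \<open>Q\<^sub>1\<close> are tagged by \<open>Col\<close> and \<open>Op\<close>, and a pair in
  \<open>Q\<^sub>n = M\<^sup>r Q\<^bsub>n-1\<^esub> \<times> Q\<^sub>1\<close> (over \<open>M\<^sup>r Q\<^sub>0\<close>, \<open>n \<ge> 2\<close>) is tagged by \<open>Node\<close>; its second component
  is the root.\<close>

datatype ('c, 'q) tree =
    Col (the_col: 'c)
  | Op (the_op: 'q)
  | Node (the_node: "('c, 'q) tree list \<times> 'q")

fun root_op :: "('c, 'q) tree \<Rightarrow> 'q" where
  "root_op (Op q) = q"
| "root_op (Node (ts, q)) = q"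

fun outp :: "('q \<Rightarrow> 'c) \<Rightarrow> ('c, 'q) tree \<Rightarrow> 'c" where
  "outp t (Col c) = c"
| "outp t (Op q) = t q"
| "outp t (Node (ts, q)) = t q"

fun level :: "('c, 'd, 'q, 'p) operad \<Rightarrow> nat \<Rightarrow> (('c, 'q) tree, ('d, 'p) tree) gpd" where
  "level Q 0 = relabel Col the_col Col the_col (colours Q)"
| "level Q (Suc 0) = relabel Op the_op Op the_op (ops Q)"
| "level Q (Suc (Suc n)) = relabel Node the_node Node the_node
     (pullback (Mr (level Q (Suc n)))
        (Mr_map \<lparr>on_obj = outp (on_obj (tgt Q)), on_mor = outp (on_mor (tgt Q))\<rparr>)
        (ops Q) (src Q))"

text \<open>The operations on trees in \<open>Q\<^sub>n\<close> underlying the face and degeneracy maps. The simplicial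
  direction counts from the leaves to the root: index \<open>0\<close> is the top and index \<open>n\<close> the root.
  Throughout, \<open>s\<close>, \<open>t\<close>, \<open>m\<close>, \<open>u\<close> are source, target, composition and unit, and the equations
  apply to \<open>n \<ge> 1\<close> for \<open>cut_top\<close> and \<open>cut_root\<close>, to \<open>0 < i < n\<close> for \<open>contract\<close>, and to
  \<open>i \<le> n\<close> for \<open>insert_unit\<close>.\<close>

fun cut_top :: "('q \<Rightarrow> 'c) \<Rightarrow> nat \<Rightarrow> ('c, 'q) tree \<Rightarrow> ('c, 'q) tree" where
  "cut_top t (Suc 0) (Op q) = Col (t q)"
| "cut_top t (Suc (Suc 0)) (Node (ts, q)) = Op q"
| "cut_top t (Suc (Suc (Suc n))) (Node (ts, q)) = Node (map (cut_top t (Suc (Suc n))) ts, q)"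

fun cut_root :: "('q \<Rightarrow> 'c list) \<Rightarrow> ('c, 'q) tree \<Rightarrow> ('c, 'q) tree list" where
  "cut_root s (Op q) = map Col (s q)"
| "cut_root s (Node (ts, q)) = ts"

fun contract :: "('q list \<times> 'q \<Rightarrow> 'q) \<Rightarrow> nat \<Rightarrow> nat \<Rightarrow> ('c, 'q) tree \<Rightarrow> ('c, 'q) tree" where
  "contract m (Suc n) i (Node (ts, q)) =
     (if i < n then Node (map (contract m n i) ts, q)
      else if n = 1 then Op (m (map root_op ts, q))
      else Node (concat (map (fst \<circ> the_node) ts), m (map root_op ts, q)))"

fun insert_unit ::
  "('q \<Rightarrow> 'c list) \<Rightarrow> ('q \<Rightarrow> 'c) \<Rightarrow> ('c \<Rightarrow> 'q) \<Rightarrow> nat \<Rightarrow> nat \<Rightarrow> ('c, 'q) tree \<Rightarrow> ('c, 'q) tree" where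
  "insert_unit s t u 0 i (Col c) = Op (u c)"
| "insert_unit s t u (Suc 0) i (Op q) =
     (if i = 0 then Node (map (Op \<circ> u) (s q), q) else Node ([Op q], u (t q)))"
| "insert_unit s t u (Suc (Suc n)) i (Node (ts, q)) =
     (if i \<le> Suc n then Node (map (insert_unit s t u (Suc n) i) ts, q)
      else Node ([Node (ts, q)], u (t q)))"

record ('o, 'm) simplicial_gpd =
  simplices :: "nat \<Rightarrow> ('o, 'm) gpd"
  face :: "nat \<Rightarrow> nat \<Rightarrow> ('o, 'm, 'o, 'm) fctr"    \<comment> \<open>\<open>face X n i\<close> is \<open>d\<^sub>i\<close> on \<open>n\<close>-simplices\<close>
  degen :: "nat \<Rightarrow> nat \<Rightarrow> ('o, 'm, 'o, 'm) fctr"   \<comment> \<open>\<open>degen X n i\<close> is \<open>s\<^sub>i\<close> on \<open>n\<close>-simplices\<close>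

definition bar ::
  "('c, 'd, 'q, 'p) operad \<Rightarrow> (('c, 'q) tree list, ('d, 'p) tree list) simplicial_gpd" where
  "bar Q = \<lparr>simplices = (\<lambda>n. Mr (level Q n)),
     face = (\<lambda>n i.
       if i = n then fcomp Mr_mult (Mr_map
         \<lparr>on_obj = cut_root (on_obj (src Q)), on_mor = cut_root (on_mor (src Q))\<rparr>)
       else if i = 0 then Mr_map
         \<lparr>on_obj = cut_top (on_obj (tgt Q)) n, on_mor = cut_top (on_mor (tgt Q)) n\<rparr>
       else Mr_map
         \<lparr>on_obj = contract (on_obj (ocomp Q)) n i, on_mor = contract (on_mor (ocomp Q)) n i\<rparr>),
     degen = (\<lambda>n i. Mr_map
       \<lparr>on_obj = insert_unit (on_obj (src Q)) (on_obj (tgt Q)) (on_obj (ounit Q)) n i,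
        on_mor = insert_unit (on_mor (src Q)) (on_mor (tgt Q)) (on_mor (ounit Q)) n i\<rparr>)\<rparr>"

section \<open>Bialgebras over the rationals\<close>

text \<open>The vector space with basis \<open>B\<close> is the set of finitely supported functions with support in
  \<open>B\<close>; accordingly its tensor square has basis \<open>B \<times> B\<close>. The structure maps are given on basis
  elements and extended linearly.\<close>

definition scale :: "rat \<Rightarrow> ('b \<Rightarrow>\<^sub>0 rat) \<Rightarrow> ('b \<Rightarrow>\<^sub>0 rat)" where
  "scale c v = Poly_Mapping.map ((*) c) v"

definition delta :: "'b \<Rightarrow> ('b \<Rightarrow>\<^sub>0 rat)" where
  "delta b = Poly_Mapping.single b 1"

definition lin :: "('b \<Rightarrow> ('c \<Rightarrow>\<^sub>0 rat)) \<Rightarrow> ('b \<Rightarrow>\<^sub>0 rat) \<Rightarrow> ('c \<Rightarrow>\<^sub>0 rat)" where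
  "lin f v = (\<Sum>b\<in>Poly_Mapping.keys v. scale (Poly_Mapping.lookup v b) (f b))"

definition tensor :: "('b \<Rightarrow>\<^sub>0 rat) \<Rightarrow> ('c \<Rightarrow>\<^sub>0 rat) \<Rightarrow> ('b \<times> 'c \<Rightarrow>\<^sub>0 rat)" where
  "tensor v w = lin (\<lambda>a. lin (\<lambda>b. delta (a, b)) w) v"

record 'b bialg =
  basis :: "'b set"
  bmult :: "'b \<Rightarrow> 'b \<Rightarrow> ('b \<Rightarrow>\<^sub>0 rat)"
  bone :: "'b \<Rightarrow>\<^sub>0 rat"
  bcomult :: "'b \<Rightarrow> ('b \<times> 'b \<Rightarrow>\<^sub>0 rat)"
  bcounit :: "'b \<Rightarrow> rat"

definition vecs :: "'b bialg \<Rightarrow> ('b \<Rightarrow>\<^sub>0 rat) set" where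
  "vecs H = {v. Poly_Mapping.keys v \<subseteq> basis H}"

definition mult :: "'b bialg \<Rightarrow> ('b \<Rightarrow>\<^sub>0 rat) \<Rightarrow> ('b \<Rightarrow>\<^sub>0 rat) \<Rightarrow> ('b \<Rightarrow>\<^sub>0 rat)" where
  "mult H v w = lin (\<lambda>a. lin (bmult H a) w) v"

definition comult :: "'b bialg \<Rightarrow> ('b \<Rightarrow>\<^sub>0 rat) \<Rightarrow> ('b \<times> 'b \<Rightarrow>\<^sub>0 rat)" where
  "comult H v = lin (bcomult H) v"

definition counit :: "'b bialg \<Rightarrow> ('b \<Rightarrow>\<^sub>0 rat) \<Rightarrow> rat" where
  "counit H v = (\<Sum>b\<in>Poly_Mapping.keys v. Poly_Mapping.lookup v b * bcounit H b)"

definition tensor_mult ::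
  "'b bialg \<Rightarrow> ('b \<times> 'b \<Rightarrow>\<^sub>0 rat) \<Rightarrow> ('b \<times> 'b \<Rightarrow>\<^sub>0 rat) \<Rightarrow> ('b \<times> 'b \<Rightarrow>\<^sub>0 rat)" where
  "tensor_mult H v w =
     lin (\<lambda>(a, b). lin (\<lambda>(a', b'). tensor (bmult H a a') (bmult H b b')) w) v"

definition bialgebra :: "'b bialg \<Rightarrow> bool" where
  "bialgebra H \<longleftrightarrow>
     bone H \<in> vecs H \<and>
     (\<forall>v\<in>vecs H. Poly_Mapping.keys (comult H v) \<subseteq> basis H \<times> basis H \<and> (\<forall>w\<in>vecs H. mult H v w \<in> vecs H)) \<and>
     \<comment> \<open>algebra\<close>
     (\<forall>u\<in>vecs H. \<forall>v\<in>vecs H. \<forall>w\<in>vecs H. mult H (mult H u v) w = mult H u (mult H v w)) \<and>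
     (\<forall>v\<in>vecs H. mult H (bone H) v = v \<and> mult H v (bone H) = v) \<and>
     \<comment> \<open>coalgebra\<close>
     (\<forall>v\<in>vecs H.
        lin (\<lambda>(a, b). lin (\<lambda>(c, d). delta (c, d, b)) (bcomult H a)) (comult H v) =
        lin (\<lambda>(a, b). tensor (delta a) (bcomult H b)) (comult H v)) \<and>
     (\<forall>v\<in>vecs H. lin (\<lambda>(a, b). scale (bcounit H a) (delta b)) (comult H v) = v \<and>
                 lin (\<lambda>(a, b). scale (bcounit H b) (delta a)) (comult H v) = v) \<and>
     \<comment> \<open>compatibility\<close>
     (\<forall>v\<in>vecs H. \<forall>w\<in>vecs H.
        comult H (mult H v w) = tensor_mult H (comult H v) (comult H w) \<and>
        counit H (mult H v w) = counit H v * counit H w) \<and>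
     comult H (bone H) = tensor (bone H) (bone H) \<and> counit H (bone H) = 1"

definition bialgebra_iso ::
  "'b bialg \<Rightarrow> 'c bialg \<Rightarrow> (('b \<Rightarrow>\<^sub>0 rat) \<Rightarrow> ('c \<Rightarrow>\<^sub>0 rat)) \<Rightarrow> bool" where
  "bialgebra_iso H K \<phi> \<longleftrightarrow>
     bij_betw \<phi> (vecs H) (vecs K) \<and>
     (\<forall>v\<in>vecs H. \<forall>w\<in>vecs H. \<phi> (v + w) = \<phi> v + \<phi> w) \<and>
     (\<forall>c. \<forall>v\<in>vecs H. \<phi> (scale c v) = scale c (\<phi> v)) \<and>
     (\<forall>v\<in>vecs H. \<forall>w\<in>vecs H. \<phi> (mult H v w) = mult K (\<phi> v) (\<phi> w)) \<and>
     \<phi> (bone H) = bone K \<and>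
     (\<forall>v\<in>vecs H. comult K (\<phi> v) = lin (\<lambda>(a, b). tensor (\<phi> (delta a)) (\<phi> (delta b))) (comult H v)) \<and>
     (\<forall>v\<in>vecs H. counit K (\<phi> v) = counit H v)"

definition bialgebra_isomorphic :: "'b bialg \<Rightarrow> 'c bialg \<Rightarrow> bool" where
  "bialgebra_isomorphic H K \<longleftrightarrow> bialgebra H \<and> bialgebra K \<and> (\<exists>\<phi>. bialgebra_iso H K \<phi>)"

section \<open>The incidence bialgebra\<close>

definition Phi ::
  "('o, 'm) simplicial_gpd \<Rightarrow> 'o \<Rightarrow> 'o \<Rightarrow> 'o \<Rightarrow> _" where
  "Phi X f a b =
     hfib (hfib (simplices X 2) (simplices X 1) (face X 2 1) f) (prod_gpd (simplices X 1) (simplices X 1))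
       (fcomp (fpair (face X 2 2) (face X 2 0)) hfib_incl) (a, b)"

definition incidence_coeff ::
  "('o, 'm) simplicial_gpd \<Rightarrow> 'o \<Rightarrow> 'o \<Rightarrow> 'o \<Rightarrow> rat" where
  "incidence_coeff X f a b =
     gcard (Phi X f a b) /
       (of_nat (card (auts (simplices X 1) a)) * of_nat (card (auts (simplices X 1) b)))"

text \<open>The incidence bialgebra of a simplicial groupoid whose simplices are lists, with product
  given by concatenation of lists. The basis element \<open>None\<close> is the adjoined unit, and
  \<open>Some c\<close> is the basis element of \<open>c \<in> \<pi>\<^sub>0 X\<^sub>1\<close>.\<close>

definition incidence_bialgebra ::
  "('a list, 'm) simplicial_gpd \<Rightarrow> 'a list set option bialg" where
  "incidence_bialgebra X = \<lparr>
     basis = insert None (Some ` pi0 (simplices X 1)),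
     bmult = (\<lambda>p q. case (p, q) of
         (None, _) \<Rightarrow> delta q
       | (_, None) \<Rightarrow> delta p
       | (Some f, Some g) \<Rightarrow> delta (Some (iso_class (simplices X 1) (rep f @ rep g)))),
     bone = delta None,
     bcomult = (\<lambda>p. case p of
         None \<Rightarrow> delta (None, None)
       | Some f \<Rightarrow> Abs_poly_mapping (\<lambda>(p, q). case (p, q) of
             (Some a, Some b) \<Rightarrow>
               if a \<in> pi0 (simplices X 1) \<and> b \<in> pi0 (simplices X 1)
               then incidence_coeff X (rep f) (rep a) (rep b) else 0
           | _ \<Rightarrow> 0)),
     bcounit = (\<lambda>p. case p of
         None \<Rightarrow> 1
       | Some f \<Rightarrow> gcard (hfib (simplices X 0) (simplices X 1) (degen X 0 0) (rep f)))\<rparr>"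

section \<open>Noncommutative power series and substitution\<close>

type_synonym 'r ncps = "two list \<Rightarrow> 'r"

definition nc_one :: "'r::ring_1 ncps" where
  "nc_one \<omega> = (if \<omega> = [] then 1 else 0)"

definition nc_mult :: "'r::ring_1 ncps \<Rightarrow> 'r ncps \<Rightarrow> 'r ncps" where
  "nc_mult f g \<omega> = (\<Sum>k\<le>length \<omega>. f (take k \<omega>) * g (drop k \<omega>))"

typedef (overloaded) ('r::zero) ncps0 = "{f :: 'r ncps. f [] = 0}"
  morphisms coeff Abs_ncps0
  by (rule exI[of _ "\<lambda>_. 0"]) simp

type_synonym 'r ncps_pair = "two \<Rightarrow> 'r ncps0"

fun nc_subst_word :: "'r::ring_1 ncps_pair \<Rightarrow> two list \<Rightarrow> 'r ncps" where
  "nc_subst_word F [] = nc_one"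
| "nc_subst_word F (i # \<nu>) = nc_mult (coeff (F i)) (nc_subst_word F \<nu>)"

text \<open>In \<open>G(F\<^sup>1, F\<^sup>2)\<close> a word \<open>\<nu>\<close> only contributes to the coefficients of words at least as long as
  \<open>\<nu>\<close>, because \<open>F\<^sup>1\<close> and \<open>F\<^sup>2\<close> have no constant term.\<close>

definition nc_subst :: "'r::ring_1 ncps0 \<Rightarrow> 'r ncps_pair \<Rightarrow> 'r ncps0" where
  "nc_subst G F = Abs_ncps0
     (\<lambda>\<omega>. \<Sum>\<nu> | length \<nu> \<le> length \<omega>. coeff G \<nu> * nc_subst_word F \<nu> \<omega>)"

definition pair_comp :: "'r::ring_1 ncps_pair \<Rightarrow> 'r ncps_pair \<Rightarrow> 'r ncps_pair" where
  "pair_comp G F = (\<lambda>i. nc_subst (G i) F)"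

definition pair_id :: "'r::ring_1 ncps_pair" where
  "pair_id = (\<lambda>i. Abs_ncps0 (\<lambda>\<omega>. if \<omega> = [i] then 1 else 0))"

definition coord :: "two \<Rightarrow> two list \<Rightarrow> 'r::zero ncps_pair \<Rightarrow> 'r" where
  "coord i \<omega> F = coeff (F i) \<omega>"

section \<open>The noncommutative Faa di Bruno bialgebra in two variables\<close>

text \<open>The free monoid, written additively so that \<open>'g free_monoid \<Rightarrow>\<^sub>0 rat\<close> is the free associative
  unital algebra on \<open>'g\<close>, and \<open>'g free_monoid \<times> 'g free_monoid \<Rightarrow>\<^sub>0 rat\<close> is its tensor square as an
  algebra.\<close>

datatype 'g free_monoid = Word (letters: "'g list")

instantiation free_monoid :: (type) monoid_add
begin

definition "0 = Word []"

definition "u + v = Word (letters u @ letters v)"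

instance
  by standard (auto simp: zero_free_monoid_def plus_free_monoid_def)

end

type_synonym 'r coord_fun = "'r ncps_pair \<Rightarrow> 'r"

definition coord_funs :: "'r::ring_1 coord_fun set" where
  "coord_funs = {coord i \<omega> | i \<omega>. \<omega> \<noteq> []}"

definition coord_index :: "'r::ring_1 coord_fun \<Rightarrow> two \<times> two list" where
  "coord_index = inv_into {(i, \<omega>). \<omega> \<noteq> []} (\<lambda>(i, \<omega>). coord i \<omega>)"

type_synonym 'r fdb_tensor = "'r coord_fun free_monoid \<times> 'r coord_fun free_monoid \<Rightarrow>\<^sub>0 rat"

text \<open>The generic pairs \<open>F\<close> and \<open>G\<close>, with coefficients \<open>a \<otimes> 1\<close> and \<open>1 \<otimes> a\<close>. The comultiplication
  induced by substitution sends \<open>a\<close> to the corresponding coefficient of the generic \<open>G \<circ> F\<close>; lemma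
  \<open>fdb_comult_substitution\<close> below is the resulting identity of functions on pairs over a ring.\<close>

definition generic_F :: "'r::ring_1 fdb_tensor ncps_pair" where
  "generic_F i = Abs_ncps0 (\<lambda>\<omega>. if \<omega> = [] then 0 else delta (Word [coord i \<omega>], 0))"

definition generic_G :: "'r::ring_1 fdb_tensor ncps_pair" where
  "generic_G i = Abs_ncps0 (\<lambda>\<omega>. if \<omega> = [] then 0 else delta (0, Word [coord i \<omega>]))"

definition fdb_comult_gen :: "'r::ring_1 coord_fun \<Rightarrow> 'r fdb_tensor" where
  "fdb_comult_gen a = (case coord_index a of (i, \<omega>) \<Rightarrow> coord i \<omega> (pair_comp generic_G generic_F))"

definition fdb_counit_gen :: "'r::ring_1 coord_fun \<Rightarrow> rat" where
  "fdb_counit_gen a = (case coord_index a of (i, \<omega>) \<Rightarrow> coord i \<omega> pair_id)"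

definition faa_di_bruno_nc :: "'r::ring_1 coord_fun free_monoid bialg" where
  "faa_di_bruno_nc = \<lparr>
     basis = Word ` lists coord_funs,
     bmult = (\<lambda>u v. delta (u + v)),
     bone = delta 0,
     bcomult = (\<lambda>w. prod_list (map fdb_comult_gen (letters w))),
     bcounit = (\<lambda>w. prod_list (map fdb_counit_gen (letters w)))\<rparr>"

lemma inj_coord: "inj_on (\<lambda>(i, \<omega>). coord i \<omega> :: 'r::ring_1 coord_fun) {(i, \<omega>). \<omega> \<noteq> []}"
proof (rule inj_onI, clarify)
  fix i j and \<omega> \<omega>' :: "two list"
  assume ne: "\<omega> \<noteq> []" "\<omega>' \<noteq> []" and eq: "(coord i \<omega> :: 'r coord_fun) = coord j \<omega>'"
  define F :: "'r ncps_pair" where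
    "F = (\<lambda>k. Abs_ncps0 (\<lambda>\<rho>. if k = i \<and> \<rho> = \<omega> then 1 else 0))"
  have "coeff (F k) = (\<lambda>\<rho>. if k = i \<and> \<rho> = \<omega> then 1 else 0)" for k
    unfolding F_def by (rule Abs_ncps0_inverse) (use ne in auto)
  with fun_cong[OF eq, of F] show "i = j \<and> \<omega> = \<omega>'"
    by (auto simp: coord_def split: if_splits)
qed

lemma coord_index_coord: "\<omega> \<noteq> [] \<Longrightarrow> coord_index (coord i \<omega> :: 'r::ring_1 coord_fun) = (i, \<omega>)"
  using inv_into_f_f[OF inj_coord, of "(i, \<omega>)"] by (simp add: coord_index_def)

lemma coeff_nc_subst:
  "coeff (nc_subst G F) \<omega> = (\<Sum>\<nu> | length \<nu> \<le> length \<omega>. coeff G \<nu> * nc_subst_word F \<nu> \<omega>)"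
proof -
  have "coeff G [] = 0" using coeff[of G] by simp
  then show ?thesis unfolding nc_subst_def by (subst Abs_ncps0_inverse) auto
qed

text \<open>Elements of the tensor square are evaluated at \<open>(F, G)\<close>, for series over a ring \<open>R\<close> that is a
  rational algebra by way of \<open>h\<close>, with the coefficients of the outer series \<open>G\<close> on the left, as
  they appear in \<open>G \<circ> F\<close>.\<close>

lemma fdb_comult_substitution:
  fixes F G :: "'r::ring_1 ncps_pair" and i :: two and \<omega> :: "two list" and h :: "rat \<Rightarrow> 'r"
  assumes h: "h 1 = 1" "\<And>a b. h (a + b) = h a + h b" "\<And>a b. h (a * b) = h a * h b"
    "\<And>a r. h a * r = r * h a"
    and \<omega>: "\<omega> \<noteq> []"
  defines "T \<equiv> fdb_comult_gen (coord i \<omega> :: 'r coord_fun)"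
    and "ev \<equiv> \<lambda>F w. prod_list (map (\<lambda>a. a F) (letters w))"
  shows "(\<Sum>(u, v)\<in>Poly_Mapping.keys T. h (Poly_Mapping.lookup T (u, v)) * (ev G v * ev F u)) = coord i \<omega> (pair_comp G F)"
proof -
  define E :: "'r fdb_tensor \<Rightarrow> 'r" where
    "E S = (\<Sum>p\<in>Poly_Mapping.keys S. h (Poly_Mapping.lookup S p) * (ev G (snd p) * ev F (fst p)))" for S
  have h0: "h 0 = 0" using h(2)[of 0 0] by simp
  have E_sup: "E S = (\<Sum>p\<in>A. h (Poly_Mapping.lookup S p) * (ev G (snd p) * ev F (fst p)))"
    if "finite A" "Poly_Mapping.keys S \<subseteq> A" for S A
    unfolding E_def using that by (intro sum.mono_neutral_left) (auto simp: Poly_Mapping.in_keys_iff h0)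
  have E_add: "E (S + S') = E S + E S'" for S S'
  proof -
    let ?A = "Poly_Mapping.keys S \<union> Poly_Mapping.keys S'"
    have "E (S + S') = (\<Sum>p\<in>?A. h (Poly_Mapping.lookup (S + S') p) * (ev G (snd p) * ev F (fst p)))"
      by (rule E_sup) (simp_all add: Poly_Mapping.keys_add)
    also have "\<dots> = E S + E S'"
      by (simp add: E_sup[of ?A S] E_sup[of ?A S'] Poly_Mapping.lookup_add h(2) distrib_right sum.distrib)
    finally show ?thesis .
  qed
  have E0: "E 0 = 0" by (simp add: E_def)
  have E_sum: "E (\<Sum>x\<in>A. f x) = (\<Sum>x\<in>A. E (f x))" for A and f :: "'z \<Rightarrow> _"
    by (induction A rule: infinite_finite_induct) (auto simp: E0 E_add)
  have E_delta: "E (delta (u, v)) = ev G v * ev F u" for u v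
    by (simp add: E_def delta_def h)
  have delta_mult: "delta p * delta q = (delta (p + q) :: 'r fdb_tensor)" for p q
    by (simp add: delta_def mult_single)
  have ev_add: "ev F' (u + v) = ev F' u * ev F' v" for F' u v
    by (simp add: ev_def plus_free_monoid_def)
  have ev_simps: "ev F' 0 = 1" "ev F' (Word [a]) = a F'" for F' a
    by (auto simp: ev_def zero_free_monoid_def)
  have gF: "coeff (generic_F j :: 'r fdb_tensor ncps0) = (\<lambda>\<omega>. if \<omega> = [] then 0 else delta (Word [coord j \<omega>], 0))" for j
    unfolding generic_F_def by (rule Abs_ncps0_inverse) simp
  have gG: "coeff (generic_G j :: 'r fdb_tensor ncps0) = (\<lambda>\<omega>. if \<omega> = [] then 0 else delta (0, Word [coord j \<omega>]))" for j
    unfolding generic_G_def by (rule Abs_ncps0_inverse) simp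
  have const: "coeff K [] = 0" for K :: "'r ncps0"
    using coeff[of K] by simp
  have key: "E (delta (u, v) * nc_subst_word generic_F \<nu> \<rho>) = ev G v * ev F u * nc_subst_word F \<nu> \<rho>"
    for u v \<nu> \<rho>
  proof (induction \<nu> arbitrary: u \<rho>)
    case Nil
    then show ?case by (auto simp: nc_one_def E_delta E0)
  next
    case (Cons j \<nu>)
    have "E (delta (u, v) * (coeff (generic_F j) \<sigma> * nc_subst_word generic_F \<nu> \<tau>)) =
        ev G v * ev F u * (coeff (F j) \<sigma> * nc_subst_word F \<nu> \<tau>)" for \<sigma> \<tau>
    proof (cases "\<sigma> = []")
      case False
      then have "E (delta (u, v) * (coeff (generic_F j) \<sigma> * nc_subst_word generic_F \<nu> \<tau>)) =
          E (delta (u + Word [coord j \<sigma>], v) * nc_subst_word generic_F \<nu> \<tau>)"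
        by (simp add: gF delta_mult flip: mult.assoc)
      then show ?thesis by (simp add: Cons.IH ev_add ev_simps coord_def mult.assoc)
    qed (simp add: gF const E0)
    then show ?case by (simp add: nc_mult_def sum_distrib_left E_sum)
  qed
  have "E T = (\<Sum>\<nu> | length \<nu> \<le> length \<omega>.
      E (coeff (generic_G i) \<nu> * nc_subst_word generic_F \<nu> \<omega>))"
    by (simp add: T_def fdb_comult_gen_def coord_index_coord \<omega> coord_def pair_comp_def coeff_nc_subst E_sum)
  also have "\<dots> = (\<Sum>\<nu> | length \<nu> \<le> length \<omega>. coeff (G i) \<nu> * nc_subst_word F \<nu> \<omega>)"
    by (intro sum.cong refl) (auto simp: gG const E0 key ev_simps coord_def)
  finally show ?thesis
    by (simp add: E_def coord_def pair_comp_def coeff_nc_subst case_prod_unfold)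
qed

end

theory Submission
  imports Defs
begin

text \<open>
  All groupoids in the bar construction of \<open>Ass2\<close> are discrete, so the structure constants of the
  incidence bialgebra count two-level forests: the coefficient at \<open>a \<otimes> b\<close> is the number of forests
  of composite \<open>f\<close> with leaf level \<open>a\<close> and root level \<open>b\<close>. An operation with input word \<open>\<omega>\<close> and
  output \<open>i\<close> corresponds to the coordinate \<open>a\<^sup>i\<^sub>\<omega>\<close>, and a forest to a monomial. Expanding the
  coefficient of \<open>\<omega>\<close> in \<open>G\<^sup>i(F\<^sup>1, F\<^sup>2)\<close> amounts to cutting \<open>\<omega>\<close> into nonempty pieces and labelling
  each piece by a variable, which is the same as choosing a two-level tree with composite \<open>(\<omega>, i)\<close>.
  Hence both comultiplications agree on basis elements. The bialgebra laws are proved on the Faa di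
  Bruno side and transported along the bijection of bases.
\<close>

section \<open>Linear extension\<close>

lemma lookup_scale [simp]: "Poly_Mapping.lookup (scale c v) k = c * Poly_Mapping.lookup v k"
  by (simp add: scale_def Poly_Mapping.map.rep_eq when_def)

lemma scale_simps [simp]:
  "scale 0 v = 0" "scale 1 v = v" "scale c 0 = 0"
  "scale c (scale d v) = scale (c * d) v" "scale c (Poly_Mapping.single a r) = Poly_Mapping.single a (c * r)"
  by (rule poly_mapping_eqI, simp add: lookup_single when_def mult.assoc)+

lemma scale_add: "scale c (v + w) = scale c v + scale c w"
  and scale_add_left: "scale (c + d) v = scale c v + scale d v"
  by (rule poly_mapping_eqI, simp add: lookup_add algebra_simps)+

lemma scale_sum: "scale c (sum f A) = (\<Sum>a\<in>A. scale c (f a))"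
  by (induction A rule: infinite_finite_induct) (auto simp: scale_add)

lemma keys_scale: "Poly_Mapping.keys (scale c v) \<subseteq> Poly_Mapping.keys v"
  by (auto simp: in_keys_iff)

text \<open>The sum defining \<open>lin\<close> runs over a support that shrinks under cancellation;
  a fixed finite superset makes the values at different vectors comparable.\<close>

lemma lin_superset:
  assumes "finite A" "Poly_Mapping.keys v \<subseteq> A"
  shows "lin f v = (\<Sum>b\<in>A. scale (Poly_Mapping.lookup v b) (f b))"
  unfolding lin_def using assms by (intro sum.mono_neutral_left) (auto simp: in_keys_iff)

lemma lin_0 [simp]: "lin f 0 = 0"
  by (simp add: lin_def)

lemma lin_single [simp]: "lin f (Poly_Mapping.single b c) = scale c (f b)"
  by (simp add: lin_def)

lemma lin_delta [simp]: "lin f (delta b) = f b"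
  by (simp add: delta_def)

lemma lin_add: "lin f (v + w) = lin f v + lin f w"
proof -
  let ?A = "Poly_Mapping.keys v \<union> Poly_Mapping.keys w"
  have "lin f (v + w) = (\<Sum>b\<in>?A. scale (Poly_Mapping.lookup (v + w) b) (f b))"
    by (rule lin_superset) (simp_all add: keys_add)
  also have "\<dots> = lin f v + lin f w"
    by (simp add: lin_superset[of ?A v] lin_superset[of ?A w] lookup_add scale_add_left sum.distrib)
  finally show ?thesis .
qed

lemma lin_scale: "lin f (scale c v) = scale c (lin f v)"
  by (subst lin_superset[of "Poly_Mapping.keys v"]) (auto simp: keys_scale[THEN subsetD] scale_sum lin_def)

lemma lin_sum: "lin f (sum g A) = (\<Sum>a\<in>A. lin f (g a))"
  by (induction A rule: infinite_finite_induct) (auto simp: lin_add)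

lemma lin_lin: "lin f (lin g v) = lin (\<lambda>b. lin f (g b)) v"
  unfolding lin_def[of g v] lin_def[of "\<lambda>b. lin f (g b)"] by (simp add: lin_sum lin_scale)

lemma lin_cong: "(\<And>b. b \<in> Poly_Mapping.keys v \<Longrightarrow> f b = g b) \<Longrightarrow> lin f v = lin g v"
  by (simp add: lin_def)

lemma sum_singles: "(\<Sum>b\<in>Poly_Mapping.keys v. Poly_Mapping.single b (Poly_Mapping.lookup v b)) = v"
  by (rule poly_mapping_eqI) (simp add: lookup_sum lookup_single when_def in_keys_iff)

lemma lin_delta_id [simp]: "lin delta v = v"
  using sum_singles[of v] by (simp add: lin_def delta_def)

lemma keys_lin: "Poly_Mapping.keys (lin f v) \<subseteq> (\<Union>b\<in>Poly_Mapping.keys v. Poly_Mapping.keys (f b))"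
  unfolding lin_def by (rule order_trans[OF keys_sum]) (use keys_scale in fastforce)

lemma keys_delta [simp]: "Poly_Mapping.keys (delta b) = {b}"
  by (simp add: delta_def)

section \<open>Monoid algebras\<close>

lemma delta_mult: "delta a * delta b = (delta (a + b) :: 'a::monoid_add \<Rightarrow>\<^sub>0 rat)"
  by (simp add: delta_def mult_single)

lemma delta_0: "delta 0 = (1 :: 'a::monoid_add \<Rightarrow>\<^sub>0 rat)"
  by (simp add: delta_def)

lemma times_sum_singles:
  fixes v w :: "'a::monoid_add \<Rightarrow>\<^sub>0 rat"
  shows "v * w = (\<Sum>a\<in>Poly_Mapping.keys v. \<Sum>b\<in>Poly_Mapping.keys w.
    Poly_Mapping.single (a + b) (Poly_Mapping.lookup v a * Poly_Mapping.lookup w b))"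
  by (subst sum_singles[of v, symmetric], subst sum_singles[of w, symmetric])
    (simp only: sum_product mult_single)

lemma scale_times_scale:
  fixes v w :: "'a::monoid_add \<Rightarrow>\<^sub>0 rat"
  shows "scale c v * scale d w = scale (c * d) (v * w)"
proof -
  have "scale c v * scale d w = (\<Sum>a\<in>Poly_Mapping.keys v. Poly_Mapping.single a (c * Poly_Mapping.lookup v a)) *
      (\<Sum>b\<in>Poly_Mapping.keys w. Poly_Mapping.single b (d * Poly_Mapping.lookup w b))"
    by (subst sum_singles[of v, symmetric], subst sum_singles[of w, symmetric]) (simp only: scale_sum scale_simps)
  then show ?thesis
    by (simp add: times_sum_singles[of v w] scale_sum sum_product mult_single mult_ac)
qed

lemma scale_times [simp]: "scale c v * w = scale c (v * w)"
  and times_scale [simp]: "v * scale c w = scale c (v * w)"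
  for v w :: "'a::monoid_add \<Rightarrow>\<^sub>0 rat"
  using scale_times_scale[of c v 1 w] scale_times_scale[of 1 v c w] by simp_all

lemma lin_times_left: "lin f v * w = lin (\<lambda>a. f a * w) v"
  and lin_times_right: "w * lin f v = lin (\<lambda>a. w * f a) v"
  for w :: "'a::monoid_add \<Rightarrow>\<^sub>0 rat"
  by (simp_all add: lin_def sum_distrib_left sum_distrib_right)

text \<open>The right-hand side has the shape of \<open>mult\<close> and \<open>tensor_mult\<close>,
  so both products of the Faa di Bruno bialgebra become the ring multiplication of finitely
  supported functions on a monoid.\<close>

lemma times_eq_lin: "v * w = lin (\<lambda>a. lin (\<lambda>b. delta (a + b)) w) v" for v w :: "'a::monoid_add \<Rightarrow>\<^sub>0 rat"
proof -
  have "v * w = lin delta v * lin delta w" by simp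
  then show ?thesis unfolding lin_times_left by (simp only: lin_times_right delta_mult)
qed

definition alg_hom :: "('a::ring_1 \<Rightarrow> 'b::ring_1) \<Rightarrow> bool" where
  "alg_hom h \<longleftrightarrow> h 1 = 1 \<and> (\<forall>a b. h (a + b) = h a + h b) \<and> (\<forall>a b. h (a * b) = h a * h b)"

lemma alg_homD:
  assumes "alg_hom h"
  shows "h 1 = 1" "h (a + b) = h a + h b" "h (a * b) = h a * h b" "h 0 = 0"
proof -
  show "h 1 = 1" "h (a + b) = h a + h b" "h (a * b) = h a * h b" for a b
    using assms by (auto simp: alg_hom_def)
  from this(2)[of 0 0] show "h 0 = 0" by simp
qed

lemma alg_hom_sum: "alg_hom h \<Longrightarrow> h (sum f A) = (\<Sum>a\<in>A. h (f a))"
  by (induction A rule: infinite_finite_induct) (auto simp: alg_homD)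

lemma alg_hom_prod_list: "alg_hom h \<Longrightarrow> h (prod_list xs) = prod_list (map h xs)"
  by (induction xs) (auto simp: alg_homD)

text \<open>A homomorphism from the monoid of basis elements to the multiplicative monoid of an
  algebra extends linearly to an algebra homomorphism: both sides of the product law are bilinear
  and agree on basis elements.\<close>

lemma alg_hom_lin:
  fixes f :: "'a::monoid_add \<Rightarrow> ('b::monoid_add \<Rightarrow>\<^sub>0 rat)"
  assumes "f 0 = 1" "\<And>a b. f (a + b) = f a * f b"
  shows "alg_hom (lin f)"
  unfolding alg_hom_def
proof (intro conjI allI)
  show "lin f 1 = 1" using assms(1) by (simp flip: delta_0)
  show "lin f (v * w) = lin f v * lin f w" for v w
    unfolding times_eq_lin[of v w] lin_times_left by (simp only: lin_lin lin_delta assms(2) lin_times_right)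
qed (rule lin_add)

lemma tensor_delta [simp]: "tensor (delta a) (delta b) = delta (a, b)"
  by (simp add: tensor_def)

lemma tensor_delta_left: "tensor (delta a) w = lin (\<lambda>b. delta (a, b)) w"
  by (simp add: tensor_def)

section \<open>Substitution of noncommutative power series\<close>

lemma coeff_Nil [simp]: "coeff F [] = 0"
  using coeff[of F] by simp

lemma coeff_Abs_ncps0: "f [] = 0 \<Longrightarrow> coeff (Abs_ncps0 f) = f"
  by (rule Abs_ncps0_inverse) simp

lemma finite_words: "finite {\<nu> :: two list. length \<nu> \<le> n}"
proof -
  have "(UNIV :: two set) = {I1, I2}" using two.exhaust by auto
  then have "finite (UNIV :: two set)" by (metis finite.emptyI finite.insertI)
  from finite_lists_length_le[OF this] show ?thesis by simp
qed

section \<open>The monoid of noncommutative power series under multiplication\<close>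

lemma nc_mult_one_left [simp]: "nc_mult nc_one f = f"
proof
  fix \<omega> :: "two list"
  have "nc_mult nc_one f \<omega> = (\<Sum>k\<in>{0}. nc_one (take k \<omega>) * f (drop k \<omega>))"
    unfolding nc_mult_def by (rule sum.mono_neutral_right) (auto simp: nc_one_def)
  then show "nc_mult nc_one f \<omega> = f \<omega>" by (simp add: nc_one_def)
qed

lemma nc_mult_one_right [simp]: "nc_mult f nc_one = f"
proof
  fix \<omega> :: "two list"
  have "nc_mult f nc_one \<omega> = (\<Sum>k\<in>{length \<omega>}. f (take k \<omega>) * nc_one (drop k \<omega>))"
    unfolding nc_mult_def by (rule sum.mono_neutral_right) (auto simp: nc_one_def)
  then show "nc_mult f nc_one \<omega> = f \<omega>" by (simp add: nc_one_def)
qed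

lemma nc_mult_assoc: "nc_mult (nc_mult f g) h = nc_mult f (nc_mult g h)"
proof
  fix \<omega> :: "two list"
  let ?n = "length \<omega>"
  have "nc_mult (nc_mult f g) h \<omega> =
      (\<Sum>k\<le>?n. \<Sum>j\<le>k. f (take j \<omega>) * g (drop j (take k \<omega>)) * h (drop k \<omega>))"
    by (auto simp: nc_mult_def sum_distrib_right min_def intro!: sum.cong)
  \<comment> \<open>Two cuts of \<omega> at positions j \<le> k are recorded instead by the first
    position and the distance to the second, as in the other bracketing.\<close>
  also have "\<dots> = (\<Sum>j\<le>?n. \<Sum>k\<le>?n - j. f (take j \<omega>) * g (drop j (take (j + k) \<omega>)) * h (drop (j + k) \<omega>))"
    unfolding sum.Sigma[OF finite_atMost ballI[OF finite_atMost]]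
    by (rule sum.reindex_bij_witness[of _ "\<lambda>(j, k). (j + k, j)" "\<lambda>(k, j). (j, k - j)"]) auto
  also have "\<dots> = nc_mult f (nc_mult g h) \<omega>"
    by (auto simp: nc_mult_def sum_distrib_left mult.assoc drop_take add.commute intro!: sum.cong)
  finally show "nc_mult (nc_mult f g) h \<omega> = nc_mult f (nc_mult g h) \<omega>" .
qed

lemma nc_subst_word_append: "nc_subst_word F (\<mu> @ \<nu>) = nc_mult (nc_subst_word F \<mu>) (nc_subst_word F \<nu>)"
  by (induction \<mu>) (simp_all add: nc_mult_assoc)

text \<open>Each letter of \<nu> is replaced by a series without constant term and therefore uses up
  at least one letter of \<omega>.\<close>

lemma nc_subst_word_eq_0: "length \<omega> < length \<nu> \<Longrightarrow> nc_subst_word F \<nu> \<omega> = 0"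
proof (induction \<nu> arbitrary: \<omega>)
  case (Cons i \<nu>)
  have "coeff (F i) (take k \<omega>) * nc_subst_word F \<nu> (drop k \<omega>) = 0" if "k \<le> length \<omega>" for k
    using Cons that by (cases k) auto
  then show ?case by (simp add: nc_mult_def)
qed simp

section \<open>Multiplicativity and associativity of substitution\<close>

lemma commute_nc_subst_word:
  assumes "\<And>j \<beta>. c * coeff (F j) \<beta> = coeff (F j) \<beta> * c"
  shows "c * nc_subst_word F \<nu> \<omega> = nc_subst_word F \<nu> \<omega> * c"
proof (induction \<nu> arbitrary: \<omega>)
  case (Cons i \<nu>)
  have "c * (coeff (F i) \<alpha> * nc_subst_word F \<nu> \<beta>) = coeff (F i) \<alpha> * nc_subst_word F \<nu> \<beta> * c" for \<alpha> \<beta>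
    by (metis Cons assms mult.assoc)
  then show ?case by (simp add: nc_mult_def sum_distrib_left sum_distrib_right)
qed (simp add: nc_one_def)

text \<open>Substitution into an outer series that may have a constant term. Products such as
  \<open>nc_subst_word G \<rho>\<close> include the empty one, \<open>nc_one\<close>, so an
  induction over \<rho> leaves the type \<open>ncps0\<close>.\<close>

definition nc_sub :: "'r::ring_1 ncps \<Rightarrow> 'r ncps_pair \<Rightarrow> 'r ncps" where
  "nc_sub g F \<omega> = (\<Sum>\<nu> | length \<nu> \<le> length \<omega>. g \<nu> * nc_subst_word F \<nu> \<omega>)"

lemma coeff_nc_subst_eq_sub: "coeff (nc_subst G F) = nc_sub (coeff G) F"
  by (rule ext) (simp add: coeff_nc_subst nc_sub_def)

text \<open>The range of summation in \<open>nc_sub\<close> depends on the word whose coefficient is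
  taken. A common bound lets coefficients of different words be multiplied and sums be
  interchanged.\<close>

lemma nc_sub_bound:
  assumes "length \<omega> \<le> n"
  shows "nc_sub g F \<omega> = (\<Sum>\<nu> | length \<nu> \<le> n. g \<nu> * nc_subst_word F \<nu> \<omega>)"
  unfolding nc_sub_def using assms finite_words
  by (intro sum.mono_neutral_left) (auto simp: nc_subst_word_eq_0)

lemma nc_sub_one: "nc_sub nc_one F = nc_one"
proof
  fix \<omega> :: "two list"
  have "nc_sub nc_one F \<omega> = (\<Sum>\<nu>\<in>{[]}. nc_one \<nu> * nc_subst_word F \<nu> \<omega>)"
    unfolding nc_sub_def using finite_words by (intro sum.mono_neutral_right) (auto simp: nc_one_def)
  then show "nc_sub nc_one F \<omega> = nc_one \<omega>" by (simp add: nc_one_def)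
qed

text \<open>Expanding the left side puts the coefficients of f and g in front of the substituted
  words of F, while on the right each precedes its own word. Moving the coefficient of g past the
  word substituted for f is what \<open>comm\<close> is for.\<close>

lemma nc_sub_mult:
  assumes comm: "\<And>\<alpha> j \<beta>. g \<alpha> * coeff (F j) \<beta> = coeff (F j) \<beta> * g \<alpha>"
  shows "nc_sub (nc_mult f g) F = nc_mult (nc_sub f F) (nc_sub g F)"
proof
  fix \<omega> :: "two list"
  let ?n = "length \<omega>" and ?W = "nc_subst_word F"
  let ?A = "{\<nu> :: two list. length \<nu> \<le> length \<omega>}"
  let ?t = "\<lambda>\<alpha> \<beta>. f \<alpha> * g \<beta> * ?W (\<alpha> @ \<beta>) \<omega>"
  have swap: "g \<beta> * (?W \<alpha> \<sigma> * r) = ?W \<alpha> \<sigma> * (g \<beta> * r)" for \<alpha> \<beta> \<sigma> r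
    using commute_nc_subst_word[of "g \<beta>" F \<alpha> \<sigma>, OF comm] by (metis mult.assoc)
  have zero: "?t \<alpha> \<beta> = 0" if "?n < length \<alpha> + length \<beta>" for \<alpha> \<beta>
    using that by (simp add: nc_subst_word_eq_0)
  have "nc_sub (nc_mult f g) F \<omega> = (\<Sum>\<nu>\<in>?A. \<Sum>k\<le>length \<nu>. ?t (take k \<nu>) (drop k \<nu>))"
    by (simp add: nc_sub_def nc_mult_def sum_distrib_right)
  also have "\<dots> = (\<Sum>(\<nu>, k)\<in>Sigma ?A (\<lambda>\<nu>. {..length \<nu>}). ?t (take k \<nu>) (drop k \<nu>))"
    by (rule sum.Sigma) (auto simp: finite_words)
  \<comment> \<open>A word with a cut position is the same as the pair of its two parts.\<close>
  also have "\<dots> = (\<Sum>(\<alpha>, \<beta>)\<in>{(\<alpha>, \<beta>). length (\<alpha> @ \<beta>) \<le> ?n}. ?t \<alpha> \<beta>)"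
    by (rule sum.reindex_bij_witness[of _ "\<lambda>(\<alpha>, \<beta>). (\<alpha> @ \<beta>, length \<alpha>)" "\<lambda>(\<nu>, k). (take k \<nu>, drop k \<nu>)"])
      auto
  \<comment> \<open>The full square makes the two sums independent; the added pairs have a
    concatenation longer than \<omega> and contribute \<open>0\<close>.\<close>
  also have "\<dots> = (\<Sum>(\<alpha>, \<beta>)\<in>?A \<times> ?A. ?t \<alpha> \<beta>)"
    using zero by (intro sum.mono_neutral_left) (auto simp: finite_words intro!: leI)
  also have "\<dots> = (\<Sum>(\<alpha>, \<beta>)\<in>?A \<times> ?A. \<Sum>j\<le>?n. f \<alpha> * ?W \<alpha> (take j \<omega>) * (g \<beta> * ?W \<beta> (drop j \<omega>)))"
    by (simp add: nc_subst_word_append nc_mult_def sum_distrib_left mult.assoc swap)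
  also have "\<dots> = (\<Sum>j\<le>?n. \<Sum>(\<alpha>, \<beta>)\<in>?A \<times> ?A. f \<alpha> * ?W \<alpha> (take j \<omega>) * (g \<beta> * ?W \<beta> (drop j \<omega>)))"
    unfolding case_prod_unfold by (rule sum.swap)
  also have "\<dots> = (\<Sum>j\<le>?n. nc_sub f F (take j \<omega>) * nc_sub g F (drop j \<omega>))"
    by (simp add: nc_sub_bound[where n = ?n] sum_product sum.cartesian_product)
  finally show "nc_sub (nc_mult f g) F \<omega> = nc_mult (nc_sub f F) (nc_sub g F) \<omega>"
    by (simp add: nc_mult_def)
qed

lemma nc_subst_word_subst:
  assumes comm: "\<And>i \<alpha> j \<beta>. coeff (G i) \<alpha> * coeff (F j) \<beta> = coeff (F j) \<beta> * coeff (G i) \<alpha>"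
  shows "nc_subst_word (\<lambda>i. nc_subst (G i) F) \<rho> = nc_sub (nc_subst_word G \<rho>) F"
proof (induction \<rho>)
  case (Cons i \<rho>)
  have "nc_subst_word G \<rho> \<alpha> * coeff (F j) \<beta> = coeff (F j) \<beta> * nc_subst_word G \<rho> \<alpha>" for \<alpha> j \<beta>
    by (rule commute_nc_subst_word[symmetric]) (simp add: comm)
  from nc_sub_mult[OF this] show ?case by (simp add: Cons coeff_nc_subst_eq_sub)
qed (simp add: nc_sub_one)

text \<open>The commutation hypothesis matters: for H = xx, G^1 = r x and F^1 = s x the two sides
  have the coefficients r r s s and r s r s at xx. Generic series in different tensor factors
  satisfy it.\<close>

lemma nc_subst_assoc:
  assumes comm: "\<And>i \<alpha> j \<beta>. coeff (G i) \<alpha> * coeff (F j) \<beta> = coeff (F j) \<beta> * coeff (G i) \<alpha>"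
  shows "nc_subst (nc_subst H G) F = nc_subst H (\<lambda>i. nc_subst (G i) F)"
proof -
  have "nc_sub (nc_sub (coeff H) G) F \<omega> = nc_sub (coeff H) (\<lambda>i. nc_subst (G i) F) \<omega>" for \<omega>
  proof -
    let ?A = "{\<nu> :: two list. length \<nu> \<le> length \<omega>}"
    have "nc_sub (nc_sub (coeff H) G) F \<omega> =
        (\<Sum>\<nu>\<in>?A. (\<Sum>\<rho>\<in>?A. coeff H \<rho> * nc_subst_word G \<rho> \<nu>) * nc_subst_word F \<nu> \<omega>)"
      unfolding nc_sub_def[of "nc_sub _ _"] by (rule sum.cong) (auto simp: nc_sub_bound[where n = "length \<omega>"])
    also have "\<dots> = (\<Sum>\<rho>\<in>?A. coeff H \<rho> * nc_sub (nc_subst_word G \<rho>) F \<omega>)"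
      by (simp add: nc_sub_def sum_distrib_left sum_distrib_right mult.assoc) (rule sum.swap)
    finally show ?thesis
      unfolding nc_sub_def[of "coeff H"] by (simp add: nc_subst_word_subst[OF comm])
  qed
  then show ?thesis by (intro coeff_inject[THEN iffD1] ext) (simp add: coeff_nc_subst_eq_sub)
qed

section \<open>The identity pair is neutral for substitution\<close>

lemma coeff_pair_id: "coeff (pair_id i) \<omega> = (if \<omega> = [i] then 1 else 0)"
  unfolding pair_id_def by (subst coeff_Abs_ncps0) auto

lemma nc_subst_word_pair_id: "nc_subst_word pair_id \<nu> \<omega> = (if \<omega> = \<nu> then 1 else 0)"
proof (induction \<nu> arbitrary: \<omega>)
  case (Cons i \<nu>)
  \<comment> \<open>Only the cut after the first letter contributes, since \<open>pair_id i\<close>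
    has a one-letter word as its only term. The intersection is empty when \<omega> has no letter to
    cut off.\<close>
  have "nc_subst_word pair_id (i # \<nu>) \<omega> =
      (\<Sum>k\<in>{..length \<omega>} \<inter> {1}. coeff (pair_id i) (take k \<omega>) * nc_subst_word pair_id \<nu> (drop k \<omega>))"
    unfolding nc_subst_word.simps nc_mult_def
    by (rule sum.mono_neutral_right)
      (auto simp: coeff_pair_id take_Suc_conv_app_nth dest: arg_cong[where f = length])
  then show ?case by (cases \<omega>) (auto simp: coeff_pair_id Cons)
qed (simp add: nc_one_def)

lemma nc_subst_pair_id_right: "nc_subst G pair_id = G"
proof (intro coeff_inject[THEN iffD1] ext)
  show "coeff (nc_subst G pair_id) \<omega> = coeff G \<omega>" for \<omega>
    by (simp add: coeff_nc_subst nc_subst_word_pair_id finite_words if_distrib[of "(*) _"] cong: if_cong)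
qed

lemma nc_subst_pair_id_left: "nc_subst (pair_id i) F = F i"
proof (intro coeff_inject[THEN iffD1] ext)
  fix \<omega> :: "two list"
  show "coeff (nc_subst (pair_id i) F) \<omega> = coeff (F i) \<omega>"
  proof (cases \<omega>)
    case (Cons j \<omega>')
    then show ?thesis
      by (simp add: coeff_nc_subst coeff_pair_id finite_words if_distrib[of "\<lambda>x. x * _"] cong: if_cong)
  qed simp
qed

text \<open>The empty word is treated separately so that the result lies in \<open>ncps0\<close> for
  every function h; when \<open>h 0 = 0\<close> this is coefficientwise application.\<close>

definition ncps0_map :: "('r::zero \<Rightarrow> 's::zero) \<Rightarrow> 'r ncps0 \<Rightarrow> 's ncps0" where
  "ncps0_map h F = Abs_ncps0 (\<lambda>\<omega>. if \<omega> = [] then 0 else h (coeff F \<omega>))"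

lemma coeff_ncps0_map: "h 0 = 0 \<Longrightarrow> coeff (ncps0_map h F) \<omega> = h (coeff F \<omega>)"
  unfolding ncps0_map_def by (subst coeff_Abs_ncps0) auto

lemma nc_subst_word_hom:
  assumes h: "alg_hom h"
  shows "h (nc_subst_word F \<nu> \<omega>) = nc_subst_word (\<lambda>i. ncps0_map h (F i)) \<nu> \<omega>"
  by (induction \<nu> arbitrary: \<omega>)
    (auto simp: nc_one_def nc_mult_def alg_homD[OF h] alg_hom_sum[OF h] coeff_ncps0_map)

lemma coeff_nc_subst_hom:
  assumes h: "alg_hom h"
  shows "h (coeff (nc_subst G F) \<omega>) = coeff (nc_subst (ncps0_map h G) (\<lambda>i. ncps0_map h (F i))) \<omega>"
  by (simp add: coeff_nc_subst alg_homD[OF h] alg_hom_sum[OF h] coeff_ncps0_map nc_subst_word_hom[OF h])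

lemma ncps0_map_subst:
  assumes h: "alg_hom h"
  shows "ncps0_map h (nc_subst G F) = nc_subst (ncps0_map h G) (\<lambda>i. ncps0_map h (F i))"
  by (intro coeff_inject[THEN iffD1] ext) (simp add: coeff_ncps0_map alg_homD[OF h] coeff_nc_subst_hom[OF h])

section \<open>The Faa di Bruno bialgebra\<close>

text \<open>Collects the values of a map on all generators into a pair of series, so that a family
  of identities, one for each generator, becomes a single identity of substitutions.\<close>

definition series_of :: "('r::ring_1 coord_fun \<Rightarrow> 's::zero) \<Rightarrow> two \<Rightarrow> 's ncps0" where
  "series_of e i = Abs_ncps0 (\<lambda>\<omega>. if \<omega> = [] then 0 else e (coord i \<omega>))"

lemma coeff_series_of: "coeff (series_of e i) \<omega> = (if \<omega> = [] then 0 else e (coord i \<omega>))"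
  unfolding series_of_def by (subst coeff_Abs_ncps0) auto

lemma ncps0_map_series_of: "h 0 = 0 \<Longrightarrow> ncps0_map h (series_of e i) = series_of (\<lambda>a. h (e a)) i"
  by (intro coeff_inject[THEN iffD1] ext) (simp add: coeff_ncps0_map coeff_series_of)

lemma generic_series:
  "generic_F = series_of (\<lambda>a. delta (Word [a], 0))" "generic_G = series_of (\<lambda>a. delta (0, Word [a]))"
  by (auto simp: generic_F_def generic_G_def series_of_def)

lemma series_of_comult_gen: "series_of fdb_comult_gen i = nc_subst (generic_G i) generic_F"
  by (intro coeff_inject[THEN iffD1] ext)
    (simp add: coeff_series_of fdb_comult_gen_def coord_index_coord pair_comp_def, simp add: coord_def)

lemma fdb_counit_gen_coord: "\<omega> \<noteq> [] \<Longrightarrow> fdb_counit_gen (coord i \<omega>) = (if \<omega> = [i] then 1 else 0)"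
  by (simp add: fdb_counit_gen_def coord_index_coord) (simp add: coord_def coeff_pair_id)

type_synonym 'r fdb_word = "'r coord_fun free_monoid"

abbreviation fdb :: "'r::ring_1 coord_fun free_monoid bialg" where
  "fdb \<equiv> faa_di_bruno_nc"

lemma fdb_simps:
  "basis fdb = Word ` lists coord_funs" "bmult fdb = (\<lambda>u v. delta (u + v))" "bone fdb = 1"
  "bcomult fdb (Word as) = prod_list (map fdb_comult_gen as)"
  "bcounit fdb (Word as) = prod_list (map fdb_counit_gen as)"
  by (simp_all add: faa_di_bruno_nc_def delta_0)

lemma fdb_comult_hom: "bcomult fdb 0 = 1" "bcomult fdb (u + v) = bcomult fdb u * bcomult fdb v"
  and fdb_counit_hom: "bcounit fdb 0 = 1" "bcounit fdb (u + v) = bcounit fdb u * bcounit fdb v"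
  by (simp_all add: faa_di_bruno_nc_def zero_free_monoid_def plus_free_monoid_def)

lemma fdb_mult: "mult fdb v w = v * w"
  by (simp add: mult_def fdb_simps times_eq_lin)

lemma fdb_tensor_mult: "tensor_mult fdb v w = v * w"
  by (simp add: tensor_mult_def fdb_simps times_eq_lin case_prod_unfold plus_prod_def)

lemma alg_hom_fdb_comult: "alg_hom (comult fdb)"
  unfolding comult_def[abs_def] by (rule alg_hom_lin) (simp_all add: fdb_comult_hom)

text \<open>Viewing the scalars as the line spanned by b makes the counit an instance of
  \<open>lin\<close>, to which the lemmas on linear extension apply.\<close>

lemma lin_single_counit:
  fixes H :: "'a bialg"
  shows "lin (\<lambda>a. Poly_Mapping.single b (bcounit H a)) v = Poly_Mapping.single b (counit H v)"
proof -
  have "Poly_Mapping.single b (sum f A) = (\<Sum>a\<in>A. Poly_Mapping.single b (f a))" for f :: "'a \<Rightarrow> rat" and A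
    by (induction A rule: infinite_finite_induct) (auto simp: single_add)
  then show ?thesis by (simp add: lin_def counit_def)
qed

lemma fdb_counit_mult: "counit fdb (v * w) = counit fdb v * counit fdb w"
proof -
  \<comment> \<open>The scalars are embedded as the multiples of the unit in the monoid algebra of
    \<open>nat\<close>, so that the target is an algebra.\<close>
  have "alg_hom (lin (\<lambda>a. Poly_Mapping.single (0 :: nat) (bcounit fdb a)))"
    by (rule alg_hom_lin) (simp_all add: fdb_counit_hom mult_single)
  from alg_homD(3)[OF this, of v w] show ?thesis
    by (simp add: lin_single_counit mult_single) (metis lookup_single_eq)
qed

lemma fdb_hom_eqI:
  assumes h: "alg_hom h" "alg_hom k"
    and eq: "\<And>i. series_of (\<lambda>a. h (fdb_comult_gen a)) i = series_of (\<lambda>a. k (fdb_comult_gen a)) i"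
    and w: "w \<in> basis fdb"
  shows "h (bcomult fdb w) = k (bcomult fdb w)"
proof -
  obtain as where as: "w = Word as" "as \<in> lists coord_funs" using w by (auto simp: fdb_simps)
  have "h (fdb_comult_gen a) = k (fdb_comult_gen a)" if "a \<in> coord_funs" for a
  proof -
    from that obtain i \<omega> where "a = coord i \<omega>" "\<omega> \<noteq> []" by (auto simp: coord_funs_def)
    with arg_cong[OF eq[of i], of "\<lambda>F. coeff F \<omega>"] show ?thesis by (simp add: coeff_series_of)
  qed
  with as show ?thesis
    by (auto simp: fdb_simps alg_hom_prod_list[OF h(1)] alg_hom_prod_list[OF h(2)] in_lists_conv_set
        intro!: arg_cong[of _ _ prod_list])
qed

text \<open>Algebra homomorphisms commute with substitution. An algebra homomorphism applied after
  the comultiplication is thus computed on all generators by substituting the images of the generic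
  series; coassociativity and the counit laws both reduce to this.\<close>

lemma series_of_hom_comult_gen:
  assumes h: "alg_hom h"
  shows "series_of (\<lambda>a. h (fdb_comult_gen a)) i =
    nc_subst (series_of (\<lambda>a. h (delta (0, Word [a]))) i) (series_of (\<lambda>a. h (delta (Word [a], 0))))"
proof -
  have "series_of (\<lambda>a. h (fdb_comult_gen a)) i = ncps0_map h (nc_subst (generic_G i) generic_F)"
    by (simp add: ncps0_map_series_of alg_homD[OF h] flip: series_of_comult_gen)
  then show ?thesis
    by (simp add: ncps0_map_subst[OF h] ncps0_map_series_of alg_homD[OF h] generic_series)
qed

text \<open>Both sides of coassociativity are algebra homomorphisms into the triple tensor power. On
  generators they are the coefficients of \<open>H \<circ> (G \<circ> F)\<close> and \<open>(H \<circ> G) \<circ> F\<close> for the generic series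
  \<open>F\<close>, \<open>G\<close>, \<open>H\<close> with coefficients in the three tensor factors, which commute with each other.\<close>

lemma fdb_coassoc:
  fixes w :: "'r::ring_1 coord_fun free_monoid"
  assumes w: "w \<in> basis fdb"
  shows "lin (\<lambda>(a, b). lin (\<lambda>(c, d). delta (c, d, b)) (bcomult fdb a)) (bcomult fdb w) =
    lin (\<lambda>(a, b). tensor (delta a) (bcomult fdb b)) (bcomult fdb w)"
proof -
  \<comment> \<open>\<open>h12\<close> and \<open>h23\<close> embed the tensor square as the first
    two and the last two factors of the triple tensor power; \<open>lin L\<close> and
    \<open>lin R\<close> are \<Delta> \<otimes> id and id \<otimes> \<Delta>.\<close>
  define h12 :: "('r fdb_word \<times> 'r fdb_word \<Rightarrow>\<^sub>0 rat) \<Rightarrow> _" where "h12 = lin (\<lambda>(c, d). delta (c, d, 0 :: 'r fdb_word))"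
  define h23 :: "('r fdb_word \<times> 'r fdb_word \<Rightarrow>\<^sub>0 rat) \<Rightarrow> _" where "h23 = lin (\<lambda>(c, d). delta (0 :: 'r fdb_word, c, d))"
  define L where "L = (\<lambda>(a :: 'r fdb_word, b :: 'r fdb_word). lin (\<lambda>(c, d). delta (c, d, b)) (bcomult fdb a))"
  define R where "R = (\<lambda>(a :: 'r fdb_word, b :: 'r fdb_word). tensor (delta a) (bcomult fdb b))"
  have hom12: "alg_hom h12" unfolding h12_def
    by (rule alg_hom_lin) (auto simp: delta_mult zero_prod_def simp flip: delta_0)
  have hom23: "alg_hom h23" unfolding h23_def
    by (rule alg_hom_lin) (auto simp: delta_mult zero_prod_def simp flip: delta_0)
  \<comment> \<open>This splits \<open>L\<close> into a part in the first two factors and a part in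
    the third. Such parts commute (\<open>comm12\<close>), which gives multiplicativity of
    \<open>L\<close>; \<open>R\<close> is treated symmetrically.\<close>
  have L: "L (a, b) = h12 (bcomult fdb a) * delta (0, 0, b)" for a b
    by (simp add: L_def h12_def lin_times_left case_prod_unfold delta_mult)
  have R: "R (a, b) = delta (a, 0, 0) * h23 (bcomult fdb b)" for a b
    by (simp add: R_def h23_def tensor_delta_left lin_times_right case_prod_unfold delta_mult flip: zero_prod_def)
  have comm12: "delta (0, 0, b) * h12 x = h12 x * delta (0, 0, b)" for b x
    by (simp add: h12_def lin_times_left lin_times_right case_prod_unfold delta_mult)
  have comm23: "h23 x * delta (a, 0, 0) = delta (a, 0, 0) * h23 x" for a x
    by (simp add: h23_def lin_times_left lin_times_right case_prod_unfold delta_mult flip: zero_prod_def)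
  have homL: "alg_hom (lin L)"
  proof (rule alg_hom_lin)
    have "L (0, 0) = delta (0, 0, 0)" by (simp add: L fdb_comult_hom alg_homD[OF hom12])
    then show "L 0 = 1" by (simp add: delta_0 flip: zero_prod_def)
    show "L (p + q) = L p * L q" for p q
    proof -
      obtain a b a' b' where pq: "p = (a, b)" "q = (a', b')" by (metis prod.exhaust)
      have "L p * L q = h12 (bcomult fdb a) * (delta (0, 0, b) * h12 (bcomult fdb a')) * delta (0, 0, b')"
        by (simp add: pq L mult.assoc)
      also have "\<dots> = h12 (bcomult fdb a) * h12 (bcomult fdb a') * (delta (0, 0, b) * delta (0, 0, b'))"
        unfolding comm12 by (simp only: mult.assoc)
      finally show ?thesis by (simp add: pq L fdb_comult_hom alg_homD[OF hom12] delta_mult)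
    qed
  qed
  have homR: "alg_hom (lin R)"
  proof (rule alg_hom_lin)
    have "R (0, 0) = delta (0, 0, 0)" by (simp add: R fdb_comult_hom alg_homD[OF hom23])
    then show "R 0 = 1" by (simp add: delta_0 flip: zero_prod_def)
    show "R (p + q) = R p * R q" for p q
    proof -
      obtain a b a' b' where pq: "p = (a, b)" "q = (a', b')" by (metis prod.exhaust)
      have "R p * R q = delta (a, 0, 0) * (h23 (bcomult fdb b) * delta (a', 0, 0)) * h23 (bcomult fdb b')"
        by (simp add: pq R mult.assoc)
      also have "\<dots> = (delta (a, 0, 0) * delta (a', 0, 0)) * (h23 (bcomult fdb b) * h23 (bcomult fdb b'))"
        unfolding comm23 by (simp only: mult.assoc)
      finally show ?thesis by (simp add: pq R fdb_comult_hom alg_homD[OF hom23] delta_mult)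
    qed
  qed
  define F where "F = series_of (\<lambda>a :: 'r coord_fun. delta (Word [a], 0 :: 'r fdb_word, 0 :: 'r fdb_word))"
  define G where "G = series_of (\<lambda>a :: 'r coord_fun. delta (0 :: 'r fdb_word, Word [a], 0 :: 'r fdb_word))"
  define H where "H = series_of (\<lambda>a :: 'r coord_fun. delta (0 :: 'r fdb_word, 0 :: 'r fdb_word, Word [a]))"
  have gen: "bcomult fdb (Word [a]) = fdb_comult_gen a" for a :: "'r coord_fun"
    by (simp add: fdb_simps)
  have delta_000: "delta (0, 0, 0) = (1 :: 'r fdb_word \<times> 'r fdb_word \<times> 'r fdb_word \<Rightarrow>\<^sub>0 rat)"
    by (simp add: delta_0 flip: zero_prod_def)
  \<comment> \<open>The generic pairs (F, G) are sent to (G \<circ> F, H) by \<open>lin L\<close>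
    and to (F, H \<circ> G) by \<open>lin R\<close>.\<close>
  have LF: "series_of (\<lambda>a. lin L (delta (Word [a], 0))) = (\<lambda>j. nc_subst (G j) F)"
    using series_of_hom_comult_gen[OF hom12]
    by (simp add: fun_eq_iff L gen G_def F_def delta_000) (simp add: h12_def)
  have LG: "series_of (\<lambda>a. lin L (delta (0, Word [a]))) = H"
    by (simp add: L fdb_comult_hom alg_homD[OF hom12] H_def)
  have RF: "series_of (\<lambda>a. lin R (delta (Word [a], 0))) = F"
    by (simp add: R fdb_comult_hom alg_homD[OF hom23] F_def)
  have RG: "series_of (\<lambda>a. lin R (delta (0, Word [a]))) = (\<lambda>j. nc_subst (H j) G)"
    using series_of_hom_comult_gen[OF hom23]
    by (simp add: fun_eq_iff R gen G_def H_def delta_000) (simp add: h23_def)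
  have "nc_subst (nc_subst (H i) G) F = nc_subst (H i) (\<lambda>j. nc_subst (G j) F)" for i
    by (rule nc_subst_assoc) (simp add: F_def G_def coeff_series_of delta_mult)
  then have "lin L (bcomult fdb w) = lin R (bcomult fdb w)"
    by (intro fdb_hom_eqI[OF homL homR _ w])
      (simp only: series_of_hom_comult_gen[OF homL] series_of_hom_comult_gen[OF homR] LF LG RF RG)
  then show ?thesis by (simp add: L_def R_def)
qed

text \<open>Both maps are algebra homomorphisms after the comultiplication. Applying the counit to
  the inner or the outer generic series turns it into \<open>pair_id\<close>, so on generators the
  laws say that \<open>pair_id\<close> is neutral on the right and on the left.\<close>

lemma fdb_counit_law:
  fixes w :: "'r::ring_1 coord_fun free_monoid"
  assumes w: "w \<in> basis fdb"
  shows "lin (\<lambda>(a, b). scale (bcounit fdb a) (delta b)) (bcomult fdb w) = delta w"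
    and "lin (\<lambda>(a, b). scale (bcounit fdb b) (delta a)) (bcomult fdb w) = delta w"
proof -
  define L R where "L = (\<lambda>(a :: 'r fdb_word, b :: 'r fdb_word). scale (bcounit fdb a) (delta b))"
    and "R = (\<lambda>(a :: 'r fdb_word, b :: 'r fdb_word). scale (bcounit fdb b) (delta a))"
  define F where "F = series_of (\<lambda>a :: 'r coord_fun. delta (Word [a]))"
  have homL: "alg_hom (lin L)" and homR: "alg_hom (lin R)"
    by (rule alg_hom_lin; auto simp: L_def R_def zero_prod_def fdb_counit_hom scale_times_scale delta_mult delta_0 mult.commute)+
  obtain as where as: "w = Word as" "as \<in> lists coord_funs" using w by (auto simp: fdb_simps)
  have prod: "prod_list (map (\<lambda>a. delta (Word [a])) as) = delta (Word as)" for as :: "'r coord_fun list"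
    by (induction as) (auto simp: delta_mult plus_free_monoid_def zero_free_monoid_def simp flip: delta_0)
  have res: "h (bcomult fdb w) = delta w"
    if h: "alg_hom h" and eq: "\<And>i. series_of (\<lambda>a. h (fdb_comult_gen a)) i = F i" for h
  proof -
    have "h (fdb_comult_gen a) = delta (Word [a])" if "a \<in> coord_funs" for a
    proof -
      from that obtain i \<omega> where "a = coord i \<omega>" "\<omega> \<noteq> []" by (auto simp: coord_funs_def)
      with arg_cong[OF eq[of i], of "\<lambda>F. coeff F \<omega>"] show ?thesis by (simp add: coeff_series_of F_def)
    qed
    with as have "map (\<lambda>a. h (fdb_comult_gen a)) as = map (\<lambda>a. delta (Word [a])) as"
      by (auto simp: in_lists_conv_set)
    then have "prod_list (map (\<lambda>a. h (fdb_comult_gen a)) as) = delta (Word as)"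
      by (simp only: prod)
    then show ?thesis by (simp add: as fdb_simps alg_hom_prod_list[OF h] comp_def)
  qed
  have id: "series_of (\<lambda>a. scale (bcounit fdb (Word [a])) (delta 0)) = (pair_id :: ('r fdb_word \<Rightarrow>\<^sub>0 rat) ncps_pair)"
    by (intro ext coeff_inject[THEN iffD1])
      (simp add: coeff_series_of coeff_pair_id fdb_simps fdb_counit_gen_coord delta_0)
  show "lin (\<lambda>(a, b). scale (bcounit fdb a) (delta b)) (bcomult fdb w) = delta w"
    unfolding L_def[symmetric]
    by (rule res[OF homL], subst series_of_hom_comult_gen[OF homL])
      (simp add: L_def id fdb_counit_hom nc_subst_pair_id_right F_def)
  show "lin (\<lambda>(a, b). scale (bcounit fdb b) (delta a)) (bcomult fdb w) = delta w"
    unfolding R_def[symmetric]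
    by (rule res[OF homR], subst series_of_hom_comult_gen[OF homR])
      (simp add: R_def id fdb_counit_hom nc_subst_pair_id_left F_def)
qed

section \<open>The comultiplication as a sum over two-level forests\<close>

definition ass_ops :: "(two list \<times> two) set" where
  "ass_ops = {q. fst q \<noteq> []}"

text \<open>The objects of \<open>Q\<^sub>2\<close> for \<open>Ass2\<close>, stripped of the tree
  constructors: two-level trees given by their leafward operations and their root.\<close>

definition ass_nodes :: "((two list \<times> two) list \<times> (two list \<times> two)) set" where
  "ass_nodes = {(qs, q). qs \<noteq> [] \<and> set qs \<subseteq> ass_ops \<and> map snd qs = fst q}"

definition ass_graft :: "(two list \<times> two) list \<times> (two list \<times> two) \<Rightarrow> two list \<times> two" where
  "ass_graft = (\<lambda>(qs, q). (concat (map fst qs), snd q))"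

definition op_word :: "(two list \<times> two) list \<Rightarrow> 'r::ring_1 fdb_word" where
  "op_word ps = Word (map (\<lambda>(\<omega>, i). coord i \<omega>) ps)"

text \<open>Equivalently, the ways to cut \<omega> into nonempty pieces labelled in order by the
  letters of \<nu>. They index the terms at \<omega> when the generic F is substituted into
  \<nu>.\<close>

definition split_word :: "two list \<Rightarrow> two list \<Rightarrow> (two list \<times> two) list set" where
  "split_word \<nu> \<omega> = {qs \<in> lists ass_ops. map snd qs = \<nu> \<and> concat (map fst qs) = \<omega>}"

lemma op_word_add: "op_word (ps @ qs) = op_word ps + op_word qs"
  by (simp add: op_word_def plus_free_monoid_def)

lemma op_word_simps: "op_word [] = 0" "op_word (p # ps) = Word [coord (snd p) (fst p)] + op_word ps"
  by (simp_all add: op_word_def zero_free_monoid_def plus_free_monoid_def case_prod_unfold)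

lemma split_word_Nil: "split_word [] \<omega> = (if \<omega> = [] then {[]} else {})"
  by (auto simp: split_word_def)

text \<open>Here k is the length of the first piece. The recursion follows that of
  \<open>nc_subst_word\<close>, and k starts at 1 because operations have nonempty input.\<close>

lemma split_word_Cons:
  "split_word (j # \<nu>) \<omega> =
    (\<lambda>(k, qs). (take k \<omega>, j) # qs) ` (SIGMA k:{1..length \<omega>}. split_word \<nu> (drop k \<omega>))" (is "?L = ?f ` ?R")
proof (intro equalityI subsetI)
  fix rs assume "rs \<in> ?L"
  then obtain \<alpha> qs where rs: "rs = (\<alpha>, j) # qs" "\<alpha> \<noteq> []" "qs \<in> lists ass_ops" "map snd qs = \<nu>"
    "\<alpha> @ concat (map fst qs) = \<omega>"
    by (auto simp: split_word_def ass_ops_def Cons_eq_map_conv map_eq_Cons_conv in_lists_conv_set)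
  then have "(length \<alpha>, qs) \<in> ?R" by (cases \<alpha>) (auto simp: split_word_def)
  moreover have "rs = ?f (length \<alpha>, qs)" using rs by auto
  ultimately show "rs \<in> ?f ` ?R" by (rule rev_image_eqI)
qed (auto simp: split_word_def ass_ops_def)

lemma inj_on_split_word_Cons:
  "inj_on (\<lambda>(k, qs). (take k \<omega>, j) # qs) (SIGMA k:{1..length \<omega>}. split_word \<nu> (drop k \<omega>))"
  by (auto simp: inj_on_def dest!: arg_cong[of "take _ _" _ length])

lemma finite_split_word: "finite (split_word \<nu> \<omega>)"
  by (induction \<nu> arbitrary: \<omega>) (auto simp: split_word_Nil split_word_Cons)

lemma nc_subst_word_generic:
  "nc_subst_word (generic_F :: 'r::ring_1 fdb_tensor ncps_pair) \<nu> \<omega> =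
    (\<Sum>qs\<in>split_word \<nu> \<omega>. delta (op_word qs, 0))"
proof (induction \<nu> arbitrary: \<omega>)
  case Nil
  show ?case
    by (auto simp: nc_one_def split_word_Nil op_word_simps delta_0 simp flip: zero_prod_def)
next
  case (Cons j \<nu>)
  let ?t = "\<lambda>k qs. delta (op_word ((take k \<omega>, j) # qs), 0) :: 'r fdb_tensor"
  \<comment> \<open>The cut at 0 drops out because the generic series has no constant term.\<close>
  have "nc_subst_word (generic_F :: 'r fdb_tensor ncps_pair) (j # \<nu>) \<omega> =
      (\<Sum>k\<in>{1..length \<omega>}. coeff (generic_F j) (take k \<omega>) * (\<Sum>qs\<in>split_word \<nu> (drop k \<omega>). delta (op_word qs, 0)))"
    unfolding nc_subst_word.simps nc_mult_def Cons.IH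
    by (rule sum.mono_neutral_right) (auto simp: not_le)
  also have "\<dots> = (\<Sum>k\<in>{1..length \<omega>}. \<Sum>qs\<in>split_word \<nu> (drop k \<omega>). ?t k qs)"
    by (rule sum.cong) (auto simp: generic_series coeff_series_of sum_distrib_left delta_mult op_word_simps)
  also have "\<dots> = (\<Sum>(k, qs)\<in>(SIGMA k:{1..length \<omega>}. split_word \<nu> (drop k \<omega>)). ?t k qs)"
    by (rule sum.Sigma) (auto simp: finite_split_word)
  also have "\<dots> = (\<Sum>qs\<in>split_word (j # \<nu>) \<omega>. delta (op_word qs, 0))"
    unfolding split_word_Cons by (subst sum.reindex[OF inj_on_split_word_Cons]) (simp add: case_prod_unfold)
  finally show ?case .
qed

text \<open>The two-level forests with composite \<open>ps\<close>; for nonempty \<open>ps\<close>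
  these are the points of the fibre of the inner face \<open>d\<^sub>1\<close>.\<close>

definition ass_fibre :: "(two list \<times> two) list \<Rightarrow> ((two list \<times> two) list \<times> (two list \<times> two)) list set" where
  "ass_fibre ps = {xs \<in> lists ass_nodes. map ass_graft xs = ps}"

lemma length_split_word: "qs \<in> split_word \<nu> \<omega> \<Longrightarrow> length \<nu> \<le> length \<omega>"
proof (induction \<nu> arbitrary: \<omega> qs)
  case (Cons j \<nu>)
  then show ?case by (fastforce simp: split_word_Cons)
qed simp

text \<open>A tree with composite (\<omega>, i) is an input word \<nu> of the root together with a
  cutting of \<omega> labelled by \<nu>; the length bound on \<nu> is the one in
  \<open>nc_subst\<close>. For empty \<omega> the right side would contain a root without inputs,
  which is not an operation.\<close>

lemma ass_graft_fibre:
  assumes "\<omega> \<noteq> []"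
  shows "{x \<in> ass_nodes. ass_graft x = (\<omega>, i)} =
    (\<lambda>(\<nu>, qs). (qs, (\<nu>, i))) ` (SIGMA \<nu>:{\<nu>. length \<nu> \<le> length \<omega>}. split_word \<nu> \<omega>)"
proof -
  have "(qs, (\<nu>, i)) \<in> {x \<in> ass_nodes. ass_graft x = (\<omega>, i)} \<longleftrightarrow> qs \<in> split_word \<nu> \<omega>" for qs \<nu>
    using assms by (auto simp: ass_nodes_def ass_graft_def split_word_def)
  moreover have "\<exists>qs \<nu>. x = (qs, (\<nu>, i))" if "ass_graft x = (\<omega>, i)" for x
    using that by (auto simp: ass_graft_def split: prod.splits)
  ultimately show ?thesis
    by (fastforce simp: image_iff dest: length_split_word)
qed

lemma finite_ass_graft_fibre: "finite {x \<in> ass_nodes. ass_graft x = p}"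
proof (cases "fst p = []")
  case True
  then have "{x \<in> ass_nodes. ass_graft x = p} = {}"
    by (auto simp: ass_nodes_def ass_graft_def ass_ops_def neq_Nil_conv)
  then show ?thesis by (simp only: finite.emptyI)
next
  case False
  then show ?thesis
    by (cases p) (auto simp: ass_graft_fibre intro!: finite_SigmaI finite_words finite_split_word)
qed

text \<open>The leafward operations come from the inner series F and form the first tensor factor,
  the root comes from the outer series G and forms the second. This is the order of
  \<open>(d\<^sub>2, d\<^sub>0)\<close>.\<close>

lemma fdb_comult_gen_eq_sum:
  assumes "\<omega> \<noteq> []"
  shows "fdb_comult_gen (coord i \<omega>) =
    (\<Sum>x | x \<in> ass_nodes \<and> ass_graft x = (\<omega>, i). delta (op_word (fst x), op_word [snd x]))"
proof -
  have "fdb_comult_gen (coord i \<omega>) = coeff (series_of fdb_comult_gen i) \<omega>"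
    using assms by (simp add: coeff_series_of)
  \<comment> \<open>For empty \<nu> the generic G has coefficient \<open>0\<close>, and the inner
    sum on the right is empty because \<omega> is not.\<close>
  also have "\<dots> = (\<Sum>\<nu> | length \<nu> \<le> length \<omega>. \<Sum>qs\<in>split_word \<nu> \<omega>. delta (op_word qs, op_word [(\<nu>, i)]))"
    unfolding series_of_comult_gen coeff_nc_subst nc_subst_word_generic
    using assms
    by (intro sum.cong)
      (auto simp: generic_series coeff_series_of sum_distrib_left delta_mult op_word_simps split_word_Nil)
  also have "\<dots> = (\<Sum>(\<nu>, qs)\<in>(SIGMA \<nu>:{\<nu>. length \<nu> \<le> length \<omega>}. split_word \<nu> \<omega>). delta (op_word qs, op_word [(\<nu>, i)]))"
    by (rule sum.Sigma) (auto simp: finite_split_word finite_words)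
  also have "\<dots> = (\<Sum>x | x \<in> ass_nodes \<and> ass_graft x = (\<omega>, i). delta (op_word (fst x), op_word [snd x]))"
    unfolding ass_graft_fibre[OF assms] by (subst sum.reindex) (auto simp: inj_on_def intro: sum.cong)
  finally show ?thesis .
qed

lemma ass_fibre_Nil: "ass_fibre [] = {[]}"
  by (auto simp: ass_fibre_def)

lemma ass_fibre_Cons:
  "ass_fibre (p # ps) = (\<lambda>(x, xs). x # xs) ` ({x \<in> ass_nodes. ass_graft x = p} \<times> ass_fibre ps)"
  by (auto simp: ass_fibre_def image_iff Cons_eq_map_conv map_eq_Cons_conv)

lemma finite_ass_fibre: "finite (ass_fibre ps)"
  by (induction ps) (simp_all add: ass_fibre_Nil ass_fibre_Cons finite_ass_graft_fibre)

text \<open>A forest with composite \<open>ps\<close> is an independent choice of a tree over each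
  entry, so multiplying out the comultiplications of the letters gives the sum over forests.\<close>

lemma fdb_comult_op_word:
  assumes "ps \<in> lists ass_ops"
  shows "bcomult fdb (op_word ps :: 'r::ring_1 fdb_word) =
    (\<Sum>xs\<in>ass_fibre ps. delta (op_word (concat (map fst xs)), op_word (map snd xs)))"
  using assms
proof (induction ps)
  case Nil
  show ?case
    by (simp add: ass_fibre_Nil op_word_simps fdb_comult_hom delta_0 flip: zero_prod_def)
next
  case (Cons p ps)
  let ?N = "{x \<in> ass_nodes. ass_graft x = p}"
  let ?t = "\<lambda>xs. delta (op_word (concat (map fst xs)), op_word (map snd xs)) :: 'r fdb_tensor"
  have p: "fst p \<noteq> []" using Cons.hyps by (simp add: ass_ops_def)
  have "bcomult fdb (op_word (p # ps) :: 'r fdb_word) =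
      (\<Sum>x\<in>?N. delta (op_word (fst x), op_word [snd x])) * (\<Sum>xs\<in>ass_fibre ps. ?t xs)"
    by (simp add: op_word_simps(2)[of p] fdb_comult_hom Cons.IH fdb_simps
        fdb_comult_gen_eq_sum[OF p, of "snd p"])
  also have "\<dots> = (\<Sum>(x, xs)\<in>?N \<times> ass_fibre ps. ?t (x # xs))"
    by (simp add: sum_product sum.cartesian_product delta_mult op_word_add op_word_simps add.assoc)
  also have "\<dots> = (\<Sum>xs\<in>ass_fibre (p # ps). ?t xs)"
    unfolding ass_fibre_Cons by (subst sum.reindex) (auto simp: inj_on_def intro: sum.cong)
  finally show ?case .
qed

section \<open>Lists of operations as a basis, and the bialgebra laws\<close>

lemma coord_funs_eq: "coord_funs = (\<lambda>(\<omega>, i). coord i \<omega>) ` ass_ops"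
  by (auto simp: coord_funs_def ass_ops_def) blast

lemma basis_fdb: "basis fdb = op_word ` lists ass_ops"
  by (simp add: fdb_simps coord_funs_eq lists_image image_image op_word_def)

lemma inj_op_word: "inj_on (op_word :: _ \<Rightarrow> 'r::ring_1 fdb_word) (lists ass_ops)"
proof -
  have "inj_on (\<lambda>(\<omega>, i). coord i \<omega> :: 'r coord_fun) ass_ops"
    using inj_coord by (fastforce simp: inj_on_def ass_ops_def)
  from inj_on_map_lists[OF this] show ?thesis by (auto simp: inj_on_def op_word_def)
qed

text \<open>By the third claim a nonempty forest has a nonempty leaf level, so the adjoined unit
  never occurs in the comultiplication of another basis element.\<close>

lemma ass_nodesD:
  assumes "xs \<in> lists ass_nodes"
  shows "concat (map fst xs) \<in> lists ass_ops" "map snd xs \<in> lists ass_ops"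
    "concat (map fst xs) = [] \<longleftrightarrow> xs = []"
  using assms by (induction xs) (auto simp: ass_nodes_def ass_ops_def in_lists_conv_set)

lemma keys_fdb_comult:
  fixes w :: "'r::ring_1 fdb_word"
  shows "w \<in> basis fdb \<Longrightarrow> Poly_Mapping.keys (bcomult fdb w) \<subseteq> basis fdb \<times> basis fdb"
proof (unfold basis_fdb, clarify)
  fix ps a b assume ps: "\<forall>p\<in>set ps. p \<in> ass_ops"
    and ab: "(a, b) \<in> Poly_Mapping.keys (bcomult fdb (op_word ps :: 'r fdb_word))"
  from ab ps obtain xs where "xs \<in> lists ass_nodes"
    "a = op_word (concat (map fst xs))" "b = op_word (map snd xs)"
    using keys_sum by (fastforce simp: fdb_comult_op_word in_lists_conv_set ass_fibre_def)
  then show "a \<in> op_word ` lists ass_ops \<and> b \<in> op_word ` lists ass_ops"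
    using ass_nodesD(1,2) by blast
qed

lemma fdb_bialgebra: "bialgebra (faa_di_bruno_nc :: 'r::ring_1 fdb_word bialg)"
  unfolding bialgebra_def
proof (intro conjI ballI)
  fix v w :: "'r fdb_word \<Rightarrow>\<^sub>0 rat"
  assume v: "v \<in> vecs fdb" and w: "w \<in> vecs fdb"
  have "Poly_Mapping.keys (v * w) \<subseteq> {a + b | a b. a \<in> Poly_Mapping.keys v \<and> b \<in> Poly_Mapping.keys w}"
    by (rule keys_mult)
  also have "\<dots> \<subseteq> basis fdb"
    using v w by (fastforce simp: vecs_def basis_fdb image_iff op_word_add[symmetric])
  finally show "mult fdb v w \<in> vecs fdb" by (simp add: vecs_def fdb_mult)
next
  fix v :: "'r fdb_word \<Rightarrow>\<^sub>0 rat"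
  assume v: "v \<in> vecs fdb"
  then have basis: "w \<in> basis fdb" if "w \<in> Poly_Mapping.keys v" for w
    using that by (auto simp: vecs_def)
  show "Poly_Mapping.keys (comult fdb v) \<subseteq> basis fdb \<times> basis fdb"
    using keys_lin keys_fdb_comult[OF basis] unfolding comult_def by fastforce
  show "lin (\<lambda>(a, b). lin (\<lambda>(c, d). delta (c, d, b)) (bcomult fdb a)) (comult fdb v) =
      lin (\<lambda>(a, b). tensor (delta a) (bcomult fdb b)) (comult fdb v)"
    unfolding comult_def lin_lin by (rule lin_cong) (rule fdb_coassoc[OF basis])
  have "lin (\<lambda>(a, b). scale (bcounit fdb a) (delta b)) (comult fdb v) = lin delta v"
    unfolding comult_def lin_lin by (rule lin_cong) (rule fdb_counit_law(1)[OF basis])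
  then show "lin (\<lambda>(a, b). scale (bcounit fdb a) (delta b)) (comult fdb v) = v" by simp
  have "lin (\<lambda>(a, b). scale (bcounit fdb b) (delta a)) (comult fdb v) = lin delta v"
    unfolding comult_def lin_lin by (rule lin_cong) (rule fdb_counit_law(2)[OF basis])
  then show "lin (\<lambda>(a, b). scale (bcounit fdb b) (delta a)) (comult fdb v) = v" by simp
next
  have "op_word [] \<in> basis (fdb :: 'r fdb_word bialg)" unfolding basis_fdb by blast
  then show "bone fdb \<in> vecs (fdb :: 'r fdb_word bialg)" by (simp add: vecs_def fdb_simps op_word_simps)
  show "comult fdb (bone fdb) = tensor (bone fdb) (bone (fdb :: 'r fdb_word bialg))"
    by (simp add: fdb_simps alg_homD[OF alg_hom_fdb_comult])
      (simp add: delta_0[symmetric] zero_prod_def)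
  show "counit (fdb :: 'r fdb_word bialg) (bone fdb) = 1"
    by (simp add: fdb_simps counit_def fdb_counit_hom)
qed (simp_all add: fdb_mult fdb_tensor_mult fdb_counit_mult alg_homD[OF alg_hom_fdb_comult] mult.assoc fdb_simps)

section \<open>Transport along a bijection of bases\<close>

text \<open>The linear extension of \<beta> is bijective and intertwines all structure maps, so the
  bialgebra laws of K are the images of those of H.\<close>

lemma bialgebra_isomorphic_basis:
  assumes H: "bialgebra H"
    and bij: "bij_betw \<beta> (basis H) (basis K)"
    and bone: "bone K = lin (\<lambda>a. delta (\<beta> a)) (bone H)"
    and bmult: "\<And>a b. a \<in> basis H \<Longrightarrow> b \<in> basis H \<Longrightarrow>
      bmult K (\<beta> a) (\<beta> b) = lin (\<lambda>a. delta (\<beta> a)) (bmult H a b)"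
    and bcomult: "\<And>a. a \<in> basis H \<Longrightarrow>
      bcomult K (\<beta> a) = lin (\<lambda>(a, b). delta (\<beta> a, \<beta> b)) (bcomult H a)"
    and bcounit: "\<And>a. a \<in> basis H \<Longrightarrow> bcounit K (\<beta> a) = bcounit H a"
  shows "bialgebra_isomorphic H K"
proof -
  define \<phi> where "\<phi> = lin (\<lambda>a. delta (\<beta> a))"
  define \<phi>2 where "\<phi>2 = lin (\<lambda>(a, b). delta (\<beta> a, \<beta> b))"
  define \<phi>3 where "\<phi>3 = lin (\<lambda>(a, b, c). delta (\<beta> a, \<beta> b, \<beta> c))"
  define \<psi> where "\<psi> = lin (\<lambda>b. delta (inv_into (basis H) \<beta> b))"
  \<comment> \<open>The hypotheses on multiplication, comultiplication and counit concern basis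
    elements, so the identities in the tensor square that use them are restricted to
    \<open>?T\<close>. It contains all values of \<open>comult H\<close> on
    \<open>vecs H\<close>.\<close>
  let ?T = "{x. Poly_Mapping.keys x \<subseteq> basis H \<times> basis H}"
  have keys_basis: "a \<in> basis H" if "v \<in> vecs H" "a \<in> Poly_Mapping.keys v" for v a
    using that by (auto simp: vecs_def)
  have \<phi>_vecs: "\<phi> v \<in> vecs K" if "v \<in> vecs H" for v
    using keys_lin[of "\<lambda>a. delta (\<beta> a)" v] that bij_betw_imp_surj_on[OF bij]
    by (auto simp: vecs_def \<phi>_def)
  have \<psi>_vecs: "\<psi> v \<in> vecs H" if "v \<in> vecs K" for v
    using keys_lin[of "\<lambda>b. delta (inv_into (basis H) \<beta> b)" v] that bij_betw_imp_surj_on[OF bij]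
    by (force simp: vecs_def \<psi>_def intro: inv_into_into)
  have \<psi>\<phi>: "\<psi> (\<phi> v) = v" if "v \<in> vecs H" for v
  proof -
    have "\<psi> (\<phi> v) = lin delta v" unfolding \<psi>_def \<phi>_def lin_lin
      by (rule lin_cong) (simp add: bij_betw_inv_into_left[OF bij] keys_basis[OF that])
    then show ?thesis by simp
  qed
  have \<phi>\<psi>: "\<phi> (\<psi> v) = v" if "v \<in> vecs K" for v
  proof -
    have "\<phi> (\<psi> v) = lin delta v" unfolding \<psi>_def \<phi>_def lin_lin
      by (rule lin_cong) (use that in \<open>auto simp: vecs_def bij_betw_inv_into_right[OF bij]\<close>)
    then show ?thesis by simp
  qed
  have mult: "mult K (\<phi> v) (\<phi> w) = \<phi> (mult H v w)" if "v \<in> vecs H" "w \<in> vecs H" for v w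
    unfolding mult_def \<phi>_def lin_lin
    by (intro lin_cong) (simp add: lin_lin bmult keys_basis[OF that(1)] keys_basis[OF that(2)] cong: lin_cong)
  have comult: "comult K (\<phi> v) = \<phi>2 (comult H v)" if "v \<in> vecs H" for v
    unfolding comult_def \<phi>_def \<phi>2_def lin_lin
    by (intro lin_cong) (simp add: bcomult keys_basis[OF that])
  have counit: "counit K (\<phi> v) = counit H v" if "v \<in> vecs H" for v
  proof -
    have "Poly_Mapping.single () (counit K (\<phi> v)) = Poly_Mapping.single () (counit H v)"
      unfolding lin_single_counit[symmetric] \<phi>_def lin_lin
      by (rule lin_cong) (simp add: bcounit keys_basis[OF that])
    then show ?thesis by (metis lookup_single_eq)
  qed
  have tensor: "tensor (\<phi> v) (\<phi> w) = \<phi>2 (tensor v w)" for v w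
    by (simp add: tensor_def \<phi>_def \<phi>2_def lin_lin)
  have tensor_bmult: "tensor (bmult K (\<beta> a) (\<beta> a')) (bmult K (\<beta> b) (\<beta> b')) =
      \<phi>2 (tensor (bmult H a a') (bmult H b b'))"
    if "a \<in> basis H" "a' \<in> basis H" "b \<in> basis H" "b' \<in> basis H" for a a' b b'
    using that by (simp add: bmult tensor flip: \<phi>_def)
  have tensor_mult: "tensor_mult K (\<phi>2 x) (\<phi>2 y) = \<phi>2 (tensor_mult H x y)"
    if "x \<in> ?T" "y \<in> ?T" for x y
    using that unfolding tensor_mult_def
    by (auto simp: \<phi>2_def lin_lin case_prod_unfold
        intro!: lin_cong tensor_bmult[unfolded \<phi>2_def case_prod_unfold])
  have coassoc1: "lin (\<lambda>(a, b). lin (\<lambda>(c, d). delta (c, d, b)) (bcomult K a)) (\<phi>2 x) =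
      \<phi>3 (lin (\<lambda>(a, b). lin (\<lambda>(c, d). delta (c, d, b)) (bcomult H a)) x)" if "x \<in> ?T" for x
    using that unfolding \<phi>2_def \<phi>3_def lin_lin
    by (intro lin_cong) (auto simp: lin_lin case_prod_unfold bcomult)
  have coassoc2: "lin (\<lambda>(a, b). tensor (delta a) (bcomult K b)) (\<phi>2 x) =
      \<phi>3 (lin (\<lambda>(a, b). tensor (delta a) (bcomult H b)) x)" if "x \<in> ?T" for x
    using that unfolding \<phi>2_def \<phi>3_def lin_lin
    by (intro lin_cong) (auto simp: lin_lin case_prod_unfold bcomult tensor_delta_left)
  have counit1: "lin (\<lambda>(a, b). scale (bcounit K a) (delta b)) (\<phi>2 x) =
      \<phi> (lin (\<lambda>(a, b). scale (bcounit H a) (delta b)) x)" if "x \<in> ?T" for x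
    using that unfolding \<phi>2_def \<phi>_def lin_lin
    by (intro lin_cong) (auto simp: lin_lin lin_scale bcounit)
  have counit2: "lin (\<lambda>(a, b). scale (bcounit K b) (delta a)) (\<phi>2 x) =
      \<phi> (lin (\<lambda>(a, b). scale (bcounit H b) (delta a)) x)" if "x \<in> ?T" for x
    using that unfolding \<phi>2_def \<phi>_def lin_lin
    by (intro lin_cong) (auto simp: lin_lin lin_scale bcounit)
  note Hs = H[unfolded bialgebra_def]
  have T: "comult H v \<in> ?T" and mv: "w \<in> vecs H \<Longrightarrow> mult H v w \<in> vecs H" if "v \<in> vecs H" for v w
    using that Hs by auto
  have one: "bone H \<in> vecs H" "bone K = \<phi> (bone H)" using Hs bone by (auto simp: \<phi>_def)
  have \<phi>2_keys: "Poly_Mapping.keys (\<phi>2 x) \<subseteq> basis K \<times> basis K" if "x \<in> ?T" for x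
    using keys_lin[of "\<lambda>(a, b). delta (\<beta> a, \<beta> b)" x] that bij_betw_imp_surj_on[OF bij]
    by (fastforce simp: \<phi>2_def)
  \<comment> \<open>Every law quantified over \<open>vecs K\<close> is pulled back along \<phi> to
    one quantified over \<open>vecs H\<close>.\<close>
  have all: "(\<forall>v\<in>vecs K. P v) \<longleftrightarrow> (\<forall>v\<in>vecs H. P (\<phi> v))" for P
    using \<phi>_vecs \<psi>_vecs \<phi>\<psi> by metis
  have K: "bialgebra K"
    unfolding bialgebra_def all one(2)
    using Hs T mv one(1)
    by (simp add: \<phi>_vecs mult comult counit \<phi>2_keys coassoc1 coassoc2 counit1 counit2 tensor_mult tensor)
  have "bij_betw \<phi> (vecs H) (vecs K)"
    by (rule bij_betw_byWitness[of _ \<psi>]) (use \<phi>\<psi> \<psi>\<phi> \<phi>_vecs \<psi>_vecs in auto)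
  then have "bialgebra_iso H K \<phi>"
    unfolding bialgebra_iso_def
    by (simp add: mult comult counit one) (simp add: \<phi>_def \<phi>2_def lin_add lin_scale case_prod_unfold)
  with H K show ?thesis by (auto simp: bialgebra_isomorphic_def)
qed

section \<open>Discrete groupoids\<close>

text \<open>Exactly one morphism starts at each object, and it is a loop. The types of objects and
  morphisms may differ, as they do for homotopy fibres.\<close>

definition discrete_gpd :: "('o, 'm) gpd \<Rightarrow> bool" where
  "discrete_gpd G \<longleftrightarrow> bij_betw (dom G) (mor G) (obj G) \<and> (\<forall>f\<in>mor G. cod G f = dom G f)"

lemma discrete_gpdD:
  assumes "discrete_gpd G" "f \<in> mor G"
  shows "dom G f \<in> obj G" "cod G f = dom G f"
  using assms by (auto simp: discrete_gpd_def bij_betw_def)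

text \<open>Unlike \<open>discrete_gpd\<close>, this identifies each object with its identity morphism.\<close>

definition strictly_discrete :: "('a, 'a) gpd \<Rightarrow> bool" where
  "strictly_discrete G \<longleftrightarrow> mor G = obj G \<and>
     (\<forall>x\<in>obj G. dom G x = x \<and> cod G x = x \<and> cmp G x x = x)"

lemma strictly_discreteD:
  assumes "strictly_discrete G"
  shows "mor G = obj G" "x \<in> obj G \<Longrightarrow> dom G x = x" "x \<in> obj G \<Longrightarrow> cod G x = x"
    "x \<in> obj G \<Longrightarrow> cmp G x x = x"
  using assms by (auto simp: strictly_discrete_def)

lemma discrete_gpd_strict: "strictly_discrete G \<Longrightarrow> discrete_gpd G"
  by (auto simp: strictly_discrete_def discrete_gpd_def bij_betw_def inj_on_def image_iff)

lemma homs_discrete: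
  assumes "discrete_gpd G" "x \<in> obj G"
  shows "homs G x x \<noteq> {}" "card (homs G x x) = 1" "homs G x y \<noteq> {} \<longleftrightarrow> x = y"
proof -
  have inj: "inj_on (dom G) (mor G)" and surj: "dom G ` mor G = obj G"
    using assms(1) by (simp_all add: discrete_gpd_def bij_betw_def)
  from surj assms(2) obtain f0 where "f0 \<in> mor G" "dom G f0 = x" by (metis imageE)
  then obtain f where f: "{g \<in> mor G. dom G g = x} = {f}"
    using inj_onD[OF inj] by blast
  have hom: "homs G x y = (if x = y then {f} else {})" for y
    unfolding f[symmetric] by (auto simp: homs_def discrete_gpdD[OF assms(1)])
  show "homs G x x \<noteq> {}" "card (homs G x x) = 1" "homs G x y \<noteq> {} \<longleftrightarrow> x = y"
    by (auto simp: hom)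
qed

lemma iso_class_discrete: "discrete_gpd G \<Longrightarrow> x \<in> obj G \<Longrightarrow> iso_class G x = {x}"
  by (auto simp: iso_class_def homs_discrete)

lemma pi0_discrete: "discrete_gpd G \<Longrightarrow> pi0 G = (\<lambda>x. {x}) ` obj G"
  by (auto simp: pi0_def iso_class_discrete)

lemma rep_singleton [simp]: "rep {x} = x"
  by (simp add: rep_def)

lemma gcard_discrete:
  assumes "discrete_gpd G"
  shows "gcard G = of_nat (card (obj G))"
proof -
  have "gcard G = (\<Sum>x\<in>obj G. 1 / of_nat (card (auts G (rep {x}))))"
    unfolding gcard_def pi0_discrete[OF assms] by (subst sum.reindex) (auto simp: inj_on_def)
  then show ?thesis by (simp add: auts_def homs_discrete[OF assms])
qed

text \<open>A morphism from F x to b in a strictly discrete groupoid exists only for F x = b and is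
  then b itself, so the homotopy fibre is the strict fibre. The weaker discreteness of A allows
  iteration: \<open>Phi\<close> is a homotopy fibre over a homotopy fibre.\<close>

lemma hfib_discrete:
  assumes A: "discrete_gpd A" and B: "strictly_discrete B"
    and F: "\<And>f. f \<in> mor A \<Longrightarrow> on_mor F f = on_obj F (dom A f)"
    and FB: "\<And>x. x \<in> obj A \<Longrightarrow> on_obj F x \<in> obj B"
  shows "obj (hfib A B F b) = (\<lambda>x. (x, b)) ` {x \<in> obj A. on_obj F x = b}"
    and "discrete_gpd (hfib A B F b)"
proof -
  have homs: "p \<in> homs B (on_obj F x) c \<longleftrightarrow> p = c \<and> on_obj F x = c" if "x \<in> obj A" for x p c
    using FB[OF that] strictly_discreteD[OF B] by (auto simp: homs_def)
  show ob: "obj (hfib A B F b) = (\<lambda>x. (x, b)) ` {x \<in> obj A. on_obj F x = b}"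
    by (auto simp: hfib_def homs)
  have mor: "mor (hfib A B F b) =
      (\<lambda>f. ((dom A f, b), f, (dom A f, b))) ` {f \<in> mor A. on_obj F (dom A f) = b}"
  proof (intro equalityI subsetI)
    fix z assume "z \<in> mor (hfib A B F b)"
    then obtain x p f y q where z: "z = ((x, p), f, (y, q))" "x \<in> obj A" "y \<in> obj A"
        "p \<in> homs B (on_obj F x) b" "q \<in> homs B (on_obj F y) b" "f \<in> homs A x y"
      by (auto simp: hfib_def)
    then have f: "f \<in> mor A" "x = dom A f" "y = dom A f" "p = b" "q = b" "on_obj F x = b"
      by (auto simp: homs homs_def[of A] discrete_gpdD[OF A])
    then show "z \<in> (\<lambda>f. ((dom A f, b), f, (dom A f, b))) ` {f \<in> mor A. on_obj F (dom A f) = b}"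
      by (intro image_eqI[of _ _ f]) (simp_all add: z(1))
  next
    fix z assume "z \<in> (\<lambda>f. ((dom A f, b), f, (dom A f, b))) ` {f \<in> mor A. on_obj F (dom A f) = b}"
    then obtain f where f: "z = ((dom A f, b), f, (dom A f, b))" "f \<in> mor A" "on_obj F (dom A f) = b"
      by auto
    with discrete_gpdD[OF A f(2)] FB[of "dom A f"] show "z \<in> mor (hfib A B F b)"
      by (auto simp: hfib_def homs homs_def[of A] F strictly_discreteD[OF B])
  qed
  have objA: "obj A = dom A ` mor A" and inj: "inj_on (dom A) (mor A)"
    using A by (simp_all add: discrete_gpd_def bij_betw_def)
  have dom_cod: "dom (hfib A B F b) = fst" "cod (hfib A B F b) = snd \<circ> snd"
    by (simp_all add: hfib_def Let_def)
  show "discrete_gpd (hfib A B F b)"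
    unfolding discrete_gpd_def[of "hfib A B F b"] ob mor dom_cod bij_betw_def objA
    using inj by (auto simp: inj_on_def image_iff)
qed

lemma strictly_discrete_Mr: "strictly_discrete G \<Longrightarrow> strictly_discrete (Mr G)"
  unfolding strictly_discrete_def Mr_def
  by (auto intro!: map_idI simp: zip_same_conv_map subset_iff)

lemma strictly_discrete_prod: "strictly_discrete A \<Longrightarrow> strictly_discrete B \<Longrightarrow> strictly_discrete (prod_gpd A B)"
  by (auto simp: strictly_discrete_def prod_gpd_def)

lemma strictly_discrete_pullback:
  assumes "strictly_discrete A" "strictly_discrete B" "on_mor F = on_obj F" "on_mor G = on_obj G"
  shows "strictly_discrete (pullback A F B G)"
  using assms by (auto simp: strictly_discrete_def pullback_def prod_gpd_def)

lemma strictly_discrete_relabel: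
  assumes "strictly_discrete G" "\<And>x. d (c x) = x"
  shows "strictly_discrete (relabel c d c d G)"
  using assms by (auto simp: strictly_discrete_def relabel_def)

lemma strictly_discrete_discrete: "strictly_discrete (discrete S)"
  by (simp add: strictly_discrete_def discrete_def)

section \<open>The simplices of the bar construction\<close>

abbreviation barX :: "((two, two list \<times> two) tree list, (two, two list \<times> two) tree list) simplicial_gpd" where
  "barX \<equiv> bar Ass2"

lemma strictly_discrete_level: "strictly_discrete (level Ass2 n)"
proof (induction "Ass2" n rule: level.induct)
  case 1
  show ?case by (simp add: Ass2_def Ass_def strictly_discrete_relabel strictly_discrete_discrete)
next
  case 2
  show ?case
    by (simp add: Ass2_def Ass_def strictly_discrete_relabel strictly_discrete_discrete
        strictly_discrete_prod strictly_discrete_Mr)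
next
  case (3 n)
  have "strictly_discrete (ops Ass2)"
    by (simp add: Ass2_def Ass_def strictly_discrete_discrete strictly_discrete_prod strictly_discrete_Mr)
  with 3 show ?case
    by (auto simp: Mr_map_def Ass2_def Ass_def
        intro!: strictly_discrete_relabel strictly_discrete_pullback strictly_discrete_Mr)
qed

lemma strictly_discrete_simplices: "strictly_discrete (simplices barX n)"
  by (simp add: bar_def strictly_discrete_Mr strictly_discrete_level)

definition ass_node :: "(two list \<times> two) list \<times> (two list \<times> two) \<Rightarrow> (two, two list \<times> two) tree" where
  "ass_node = (\<lambda>(qs, q). Node (map Op qs, q))"

lemma obj_Mr_image: "obj G = c ` S \<Longrightarrow> obj (Mr G) = map c ` (lists S - {[]})"
proof -
  assume "obj G = c ` S"
  then have "obj (Mr G) = lists (c ` S) - {[]}" by (auto simp: Mr_def)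
  also have "\<dots> = map c ` (lists S - {[]})" by (auto simp: lists_image)
  finally show ?thesis .
qed

lemma obj_levels:
  "obj (level Ass2 0) = range Col" "obj (level Ass2 1) = Op ` ass_ops"
  "obj (level Ass2 2) = ass_node ` ass_nodes"
proof -
  show 0: "obj (level Ass2 0) = range Col" by (simp add: Ass2_def Ass_def relabel_def discrete_def)
  show 1: "obj (level Ass2 1) = Op ` ass_ops"
    by (auto simp: Ass2_def Ass_def relabel_def discrete_def prod_gpd_def Mr_def ass_ops_def)
  have "obj (level Ass2 2) = Node ` {(ts, q). ts \<in> map Op ` (lists ass_ops - {[]}) \<and>
      fst q \<noteq> [] \<and> map (outp snd) ts = fst q}"
    using obj_Mr_image[OF 1]
    by (simp add: numeral_2_eq_2 relabel_def pullback_def Mr_map_def)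
      (simp add: Ass2_def Ass_def discrete_def prod_gpd_def Mr_def mem_Times_iff)
  also have "\<dots> = ass_node ` ass_nodes"
    by (force simp: ass_node_def ass_nodes_def image_iff in_lists_conv_set)
  finally show "obj (level Ass2 2) = ass_node ` ass_nodes" .
qed

lemma obj_simplices:
  "obj (simplices barX 0) = map Col ` (UNIV - {[]})"
  "obj (simplices barX 1) = map Op ` (lists ass_ops - {[]})"
  "obj (simplices barX 2) = map ass_node ` (lists ass_nodes - {[]})"
  by (simp_all only: bar_def simplicial_gpd.simps obj_Mr_image[OF obj_levels(1)]
      obj_Mr_image[OF obj_levels(2)] obj_Mr_image[OF obj_levels(3)] lists_UNIV)

text \<open>In the last two equations the maps on morphisms and objects coincide because all
  structure maps of \<open>Ass2\<close> are given by the same function on both;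
  \<open>hfib_discrete\<close> asks for this.\<close>

lemma faces:
  "on_obj (face barX 2 1) (map ass_node xs) = map Op (map ass_graft xs)"
  "on_obj (face barX 2 2) (map ass_node xs) = map Op (concat (map fst xs))"
  "on_obj (face barX 2 0) (map ass_node xs) = map Op (map snd xs)"
  "on_obj (degen barX 0 0) (map Col cs) = map Op (map (\<lambda>c. ([c], c)) cs)"
  "on_mor (face barX 2 i) = on_obj (face barX 2 i)"
  "on_mor (degen barX 0 0) = on_obj (degen barX 0 0)"
  by (auto simp: bar_def Ass2_def Ass_def fcomp_def Mr_mult_def Mr_map_def ass_node_def ass_graft_def
      numeral_2_eq_2 comp_def case_prod_unfold map_concat)

lemma inj_ass_node: "inj ass_node"
  by (auto simp: inj_def ass_node_def)

lemma ass_graft_ops: "x \<in> ass_nodes \<Longrightarrow> ass_graft x \<in> ass_ops"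
  by (auto simp: ass_nodes_def ass_graft_def ass_ops_def neq_Nil_conv)

text \<open>Both homotopy fibres are strict, so the cardinality counts forests with prescribed
  composite and levels. The condition on \<open>ps\<close> excludes the empty forest, which is not a
  simplex.\<close>

lemma gcard_Phi:
  assumes "ps \<noteq> []"
  shows "gcard (Phi barX (map Op ps) (map Op as) (map Op bs)) =
    of_nat (card {xs \<in> ass_fibre ps. concat (map fst xs) = as \<and> map snd xs = bs})"
proof -
  let ?X = "simplices barX"
  let ?A = "hfib (?X 2) (?X 1) (face barX 2 1) (map Op ps)"
  let ?F = "fcomp (fpair (face barX 2 2) (face barX 2 0)) hfib_incl"
  note disc = strictly_discreteD[OF strictly_discrete_simplices]
  have inj_Op: "map Op rs = map Op rs' \<longleftrightarrow> rs = rs'" for rs rs' :: "(two list \<times> two) list"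
    by (auto simp: inj_map_eq_map inj_def)
  have face1: "on_obj (face barX 2 1) x \<in> obj (?X 1)" if "x \<in> obj (?X 2)" for x
  proof -
    from that obtain xs where xs: "x = map ass_node xs" "xs \<in> lists ass_nodes" "xs \<noteq> []"
      unfolding obj_simplices by auto
    then show ?thesis
      unfolding xs(1) faces obj_simplices by (intro imageI) (auto simp: ass_graft_ops)
  qed
  have face20: "on_obj (face barX 2 2) x \<in> obj (?X 1)" "on_obj (face barX 2 0) x \<in> obj (?X 1)"
    if "x \<in> obj (?X 2)" for x
  proof -
    from that obtain xs where xs: "x = map ass_node xs" "xs \<in> lists ass_nodes" "xs \<noteq> []"
      unfolding obj_simplices by auto
    then show "on_obj (face barX 2 2) x \<in> obj (?X 1)" "on_obj (face barX 2 0) x \<in> obj (?X 1)"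
      unfolding xs(1) faces obj_simplices
      by (intro imageI; simp only: Diff_iff singleton_iff ass_nodesD[OF xs(2)] map_is_Nil_conv xs(3); simp)+
  qed
  note A = hfib_discrete[OF discrete_gpd_strict[OF strictly_discrete_simplices] strictly_discrete_simplices,
      of 2 "face barX 2 1" 1 "map Op ps"]
  have obA: "obj ?A = (\<lambda>x. (x, map Op ps)) ` {x \<in> obj (?X 2). on_obj (face barX 2 1) x = map Op ps}"
    and dA: "discrete_gpd ?A"
    by (rule A; simp add: faces disc face1 del: One_nat_def)+
  have morA: "on_mor ?F f = on_obj ?F (dom ?A f)" if "f \<in> mor ?A" for f
    using that by (auto simp: fcomp_def fpair_def hfib_incl_def hfib_def homs_def faces disc)
  have FB: "on_obj ?F x \<in> obj (prod_gpd (?X 1) (?X 1))" if "x \<in> obj ?A" for x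
    using that unfolding obA by (auto simp: fcomp_def fpair_def hfib_incl_def prod_gpd_def face20 simp del: One_nat_def)
  let ?Phi = "Phi barX (map Op ps) (map Op as) (map Op bs)"
  have prod: "strictly_discrete (prod_gpd (?X 1) (?X 1))"
    by (intro strictly_discrete_prod strictly_discrete_simplices)
  have obj: "obj ?Phi = (\<lambda>x. (x, (map Op as, map Op bs))) ` {x \<in> obj ?A. on_obj ?F x = (map Op as, map Op bs)}"
    and discrete: "discrete_gpd ?Phi"
    unfolding Phi_def using morA FB by (simp_all only: hfib_discrete[OF dA prod])
  let ?S = "{xs \<in> ass_fibre ps. concat (map fst xs) = as \<and> map snd xs = bs}"
  \<comment> \<open>An object of \<open>Phi\<close> is a forest together with two trivial paths, and
    so is determined by the forest.\<close>
  have "obj ?Phi =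
      (\<lambda>xs. ((map ass_node xs, map Op ps), (map Op as, map Op bs))) ` ?S"
    unfolding obj obA using assms
    by (auto simp: obj_simplices faces fcomp_def fpair_def hfib_incl_def ass_fibre_def inj_Op image_iff simp del: map_map One_nat_def)
  moreover have "card ((\<lambda>xs. ((map ass_node xs, map Op ps), (map Op as, map Op bs))) ` ?S) = card ?S"
    by (rule card_image) (auto simp: inj_on_def inj_map_eq_map[OF inj_ass_node])
  ultimately show ?thesis by (simp add: gcard_discrete[OF discrete])
qed

lemma incidence_coeff_bar:
  assumes "ps \<noteq> []" "as \<in> lists ass_ops" "as \<noteq> []" "bs \<in> lists ass_ops" "bs \<noteq> []"
  shows "incidence_coeff barX (map Op ps) (map Op as) (map Op bs) =
    of_nat (card {xs \<in> ass_fibre ps. concat (map fst xs) = as \<and> map snd xs = bs})"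
proof -
  have "card (auts (simplices barX 1) x) = 1" if "x \<in> obj (simplices barX 1)" for x
    using homs_discrete(2)[OF discrete_gpd_strict[OF strictly_discrete_simplices] that] by (simp add: auts_def)
  moreover from assms have "map Op as \<in> obj (simplices barX 1)" "map Op bs \<in> obj (simplices barX 1)"
    unfolding obj_simplices by (auto intro!: imageI)
  ultimately show ?thesis
    by (simp add: incidence_coeff_def gcard_Phi[OF assms(1)] del: One_nat_def)
qed

section \<open>The isomorphism\<close>

abbreviation incH :: "(two, two list \<times> two) tree list set option bialg" where
  "incH \<equiv> incidence_bialgebra barX"

text \<open>Isomorphism classes are singletons here. Sending the empty list to the adjoined unit
  lets all lists of operations index the basis, with concatenation as product.\<close>

definition op_class :: "(two list \<times> two) list \<Rightarrow> (two, two list \<times> two) tree list set option" where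
  "op_class ps = (if ps = [] then None else Some {map Op ps})"

lemma pi0_bar: "pi0 (simplices barX 1) = (\<lambda>ps. {map Op ps}) ` (lists ass_ops - {[]})"
  by (simp only: pi0_discrete[OF discrete_gpd_strict[OF strictly_discrete_simplices]] obj_simplices image_image)

lemma basis_incH: "basis incH = op_class ` lists ass_ops"
proof -
  have "lists ass_ops = insert [] (lists ass_ops - {[]})" by auto
  then have "op_class ` lists ass_ops = insert (op_class []) (op_class ` (lists ass_ops - {[]}))"
    by (metis image_insert)
  also have "op_class ` (lists ass_ops - {[]}) = Some ` pi0 (simplices barX 1)"
    unfolding pi0_bar image_image by (rule image_cong) (auto simp: op_class_def)
  finally show ?thesis by (simp add: incidence_bialgebra_def op_class_def)
qed

lemma inj_op_class: "inj op_class"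
proof -
  have "inj (map Op :: _ \<Rightarrow> (two, two list \<times> two) tree list)" by (rule inj_mapI) (simp add: inj_def)
  then show ?thesis unfolding inj_def op_class_def by simp
qed

lemma bmult_incH:
  assumes "ps \<in> lists ass_ops" "qs \<in> lists ass_ops"
  shows "bmult incH (op_class ps) (op_class qs) = delta (op_class (ps @ qs))"
proof (cases "ps = [] \<or> qs = []")
  case False
  then have "map Op (ps @ qs) \<in> obj (simplices barX 1)"
    using assms unfolding obj_simplices by (intro imageI) auto
  from iso_class_discrete[OF discrete_gpd_strict[OF strictly_discrete_simplices] this] False
  show ?thesis by (simp add: incidence_bialgebra_def op_class_def)
qed (auto simp: incidence_bialgebra_def op_class_def)

lemma bcomult_incH:
  assumes "ps \<in> lists ass_ops"
  shows "bcomult incH (op_class ps) =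
    (\<Sum>xs\<in>ass_fibre ps. delta (op_class (concat (map fst xs)), op_class (map snd xs)))" (is "_ = ?S")
proof (cases "ps = []")
  case True
  then show ?thesis by (simp add: incidence_bialgebra_def op_class_def ass_fibre_Nil)
next
  case False
  let ?n = "\<lambda>p q. card {xs \<in> ass_fibre ps. op_class (concat (map fst xs)) = p \<and> op_class (map snd xs) = q}"
  have look: "Poly_Mapping.lookup ?S (p, q) = of_nat (?n p q)" for p q
    by (simp add: lookup_sum delta_def lookup_single when_def finite_ass_fibre sum.If_cases Int_def
        if_distrib[of of_nat] flip: of_nat_sum)
  have ne: "xs \<noteq> []" "concat (map fst xs) \<in> lists ass_ops - {[]}" "map snd xs \<in> lists ass_ops - {[]}"
    if "xs \<in> ass_fibre ps" for xs
    using that False ass_nodesD by (auto simp: ass_fibre_def simp del: concat_eq_Nil_conv)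
  have "(case (p, q) of (Some a, Some b) \<Rightarrow>
          if a \<in> pi0 (simplices barX 1) \<and> b \<in> pi0 (simplices barX 1)
          then incidence_coeff barX (map Op ps) (rep a) (rep b) else 0 | _ \<Rightarrow> 0) =
        Poly_Mapping.lookup ?S (p, q)" for p q
  \<comment> \<open>Away from pairs of classes of nonempty lists the left side is \<open>0\<close>
    by definition; so is the right side, because both levels of a forest over nonempty
    \<open>ps\<close> are nonempty.\<close>
  proof (cases "\<exists>as\<in>lists ass_ops - {[]}. \<exists>bs\<in>lists ass_ops - {[]}. p = op_class as \<and> q = op_class bs")
    case True
    then obtain as bs where ab: "as \<in> lists ass_ops - {[]}" "bs \<in> lists ass_ops - {[]}"
      "p = op_class as" "q = op_class bs" by blast
    moreover from ab have "{map Op as} \<in> pi0 (simplices barX 1)" "{map Op bs} \<in> pi0 (simplices barX 1)"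
      unfolding pi0_bar by blast+
    ultimately show ?thesis
      by (simp add: look inj_eq[OF inj_op_class] incidence_coeff_bar[OF False])
        (simp add: op_class_def incidence_coeff_bar[OF False])
  next
    case no: False
    then have "{xs \<in> ass_fibre ps. op_class (concat (map fst xs)) = p \<and> op_class (map snd xs) = q} = {}"
      using ne(2,3) by blast
    then have "Poly_Mapping.lookup ?S (p, q) = 0" by (simp only: look card.empty of_nat_0)
    moreover have "\<not> (a \<in> pi0 (simplices barX 1) \<and> b \<in> pi0 (simplices barX 1))"
      if "p = Some a" "q = Some b" for a b
      using no that by (fastforce simp: pi0_bar op_class_def simp del: One_nat_def)
    ultimately show ?thesis
      by (auto split: option.split simp del: One_nat_def)
  qed
  then have "(\<lambda>(p, q). case (p, q) of (Some a, Some b) \<Rightarrow>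
          if a \<in> pi0 (simplices barX 1) \<and> b \<in> pi0 (simplices barX 1)
          then incidence_coeff barX (map Op ps) (rep a) (rep b) else 0 | _ \<Rightarrow> 0) =
        Poly_Mapping.lookup ?S" (is "?f = _")
    by (intro ext) (simp only: split_paired_all case_prod_conv)
  moreover have "bcomult incH (op_class ps) = Abs_poly_mapping ?f"
    by (simp only: incidence_bialgebra_def bialg.simps op_class_def False if_False option.case rep_singleton)
  \<comment> \<open>Since the function is the lookup of a finite sum, it has the finite support on
    which \<open>Abs_poly_mapping\<close> is meaningful.\<close>
  ultimately show ?thesis by (simp only: lookup_inverse)
qed

lemma bcounit_incH:
  "bcounit incH (op_class ps) = (if \<forall>p\<in>set ps. fst p = [snd p] then 1 else 0)"
proof (cases "ps = []")
  case True
  then show ?thesis by (simp add: incidence_bialgebra_def op_class_def)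
next
  case False
  let ?X = "simplices barX"
  let ?G = "hfib (?X 0) (?X 1) (degen barX 0 0) (map Op ps)"
  note disc = strictly_discreteD[OF strictly_discrete_simplices]
  have degen: "on_obj (degen barX 0 0) x \<in> obj (?X 1)" if "x \<in> obj (?X 0)" for x
  proof -
    from that obtain cs where "x = map Col cs" "cs \<noteq> []" unfolding obj_simplices by auto
    then show ?thesis
      unfolding \<open>x = map Col cs\<close> faces obj_simplices by (intro imageI) (auto simp: ass_ops_def)
  qed
  have G: "obj ?G = (\<lambda>x. (x, map Op ps)) ` {x \<in> obj (?X 0). on_obj (degen barX 0 0) x = map Op ps}"
    "discrete_gpd ?G"
    by (rule hfib_discrete[OF discrete_gpd_strict[OF strictly_discrete_simplices] strictly_discrete_simplices];
        simp add: faces disc degen del: One_nat_def)+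
  have inj_Op: "map Op rs = map Op rs' \<longleftrightarrow> rs = rs'" for rs rs' :: "(two list \<times> two) list"
    by (auto simp: inj_map_eq_map inj_def)
  \<comment> \<open>A list of colours that the degeneracy sends to \<open>ps\<close> must be the
    list of outputs, so the fibre has at most one point.\<close>
  have unit: "map (\<lambda>c. ([c], c)) cs = ps \<longleftrightarrow> cs = map snd ps \<and> (\<forall>p\<in>set ps. fst p = [snd p])" for cs
    by (induction ps arbitrary: cs) (auto simp: map_eq_Cons_conv Cons_eq_map_conv)
  have "{x \<in> obj (?X 0). on_obj (degen barX 0 0) x = map Op ps} =
      (if \<forall>p\<in>set ps. fst p = [snd p] then {map Col (map snd ps)} else {})"
    using False by (auto simp: obj_simplices faces inj_Op unit simp del: map_map) fastforce
  then show ?thesis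
    using False
    by (simp add: incidence_bialgebra_def op_class_def gcard_discrete[OF G(2)] G(1) del: One_nat_def)
qed

lemma bcounit_op_word:
  assumes "ps \<in> lists ass_ops"
  shows "bcounit fdb (op_word ps) = (if \<forall>p\<in>set ps. fst p = [snd p] then 1 else 0)"
  using assms
  by (induction ps) (auto simp: op_word_simps fdb_counit_hom fdb_simps fdb_counit_gen_coord ass_ops_def)

theorem theorem5p17:
  shows "bialgebra_isomorphic
           (faa_di_bruno_nc :: 'r::ring_1 coord_fun free_monoid bialg)
           (incidence_bialgebra (bar Ass2))"
proof (rule bialgebra_isomorphic_basis[OF fdb_bialgebra])
  \<comment> \<open>A monomial in the coordinates is read as a list of operations, which
    \<open>inv_into\<close> recovers by injectivity of \<open>op_word\<close>, and is sent to the
    class of that list.\<close>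
  define \<beta> :: "'r fdb_word \<Rightarrow> _" where "\<beta> w = op_class (inv_into (lists ass_ops) op_word w)" for w
  have \<beta>: "\<beta> (op_word ps) = op_class ps" if "ps \<in> lists ass_ops" for ps
    by (simp add: \<beta>_def inv_into_f_f[OF inj_op_word that])
  show "bij_betw \<beta> (basis fdb) (basis incH)"
    unfolding basis_fdb basis_incH
  proof (rule bij_betw_imageI)
    show "inj_on \<beta> (op_word ` lists ass_ops)"
      by (auto simp: inj_on_def \<beta> inj_eq[OF inj_op_class] simp del: lists_eq_set)
    show "\<beta> ` op_word ` lists ass_ops = op_class ` lists ass_ops"
      unfolding image_image by (rule image_cong) (simp_all add: \<beta>)
  qed
  show "bone incH = lin (\<lambda>a. delta (\<beta> a)) (bone fdb)"
    using \<beta>[of "[]"]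
    by (simp add: fdb_simps op_word_simps incidence_bialgebra_def op_class_def flip: delta_0)
  fix a assume "a \<in> basis (fdb :: 'r fdb_word bialg)"
  then obtain ps where a: "a = op_word ps" "ps \<in> lists ass_ops" by (auto simp: basis_fdb)
  show "bcomult incH (\<beta> a) = lin (\<lambda>(a, b). delta (\<beta> a, \<beta> b)) (bcomult fdb a)"
    using a ass_nodesD by (auto simp: \<beta> bcomult_incH fdb_comult_op_word lin_sum ass_fibre_def intro!: sum.cong)
  show "bcounit incH (\<beta> a) = bcounit fdb a"
    using a by (simp add: \<beta> bcounit_incH bcounit_op_word)
  fix b assume "b \<in> basis (fdb :: 'r fdb_word bialg)"
  then obtain qs where b: "b = op_word qs" "qs \<in> lists ass_ops" by (auto simp: basis_fdb)
  then show "bmult incH (\<beta> a) (\<beta> b) = lin (\<lambda>a. delta (\<beta> a)) (bmult fdb a b)"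
    using a by (simp add: \<beta> bmult_incH fdb_simps op_word_add[symmetric])
qed

end
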